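(* For every integer $d\ge 8$ there exist a compact zero-dimensional abelian group $X$, an algebraic $\mathbb{Z}^d$-action $\alpha$ on $X$ which is mixing and has zero entropy, and a homeomorphism $f:X\to X$ such that $f$ preserves the Haar measure $\lambda_X$, $f\circ\alpha(\mathbf n)=\alpha(\mathbf n)\circ f$ for all $\mathbf n\in\mathbb{Z}^d$, and $f$ is not affine.
   Context: An algebraic $\mathbb{Z}^d$-action on a compact abelian group $X$ is a homomorphism $\mathbf n\mapsto\alpha(\mathbf n)$ from $\mathbb{Z}^d$ to the group of continuous automorphisms of $X$; it preserves the Haar measure $\lambda_X$. The action is mixing if $\lambda_X(A\cap\alpha(\mathbf n)^{-1}B)\to\lambda_X(A)\lambda_X(B)$ as $\|\mathbf n\|\to\infty$ for all Borel sets $A,B$. Entropy means the entropy of the $\mathbb{Z}^d$-action with respect to $\lambda_X$. A measurable map $f:X\to Y$ between compact abelian groups is affine if there exist $c\in Y$ and a continuous surjective homomorphism $\theta:X\to Y$ with $f(x)=c+\theta(x)$ for $\lambda_X$-almost every $x$. *)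

theory Defs
  imports "HOL-Probability.Probability" "HOL-Algebra.Group"
begin

text \<open>The carrier of the compact group X is a subset of a fixed ambient type
  (nat set, of cardinality continuum), equipped with an abstract topology T
  and an abstract (HOL-Algebra) group structure G.\<close>

type_synonym univ = "nat set"

definition compact_zd_abelian_group :: "univ monoid \<Rightarrow> univ topology \<Rightarrow> bool" where
  "compact_zd_abelian_group G T \<longleftrightarrow>
     comm_group G \<and> topspace T = carrier G \<and>
     compact_space T \<and> Hausdorff_space T \<and> T dim_le 0 \<and>
     continuous_map (prod_topology T T) T (\<lambda>(x, y). x \<otimes>\<^bsub>G\<^esub> y) \<and>
     continuous_map T T (\<lambda>x. inv\<^bsub>G\<^esub> x)"

definition borel_of_top :: "univ topology \<Rightarrow> univ measure" where
  "borel_of_top T = sigma (topspace T) {U. openin T U}"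

text \<open>Haar measure: translation invariant Borel probability measure
  (unique on a compact group).\<close>
definition is_haar :: "univ monoid \<Rightarrow> univ topology \<Rightarrow> univ measure \<Rightarrow> bool" where
  "is_haar G T M \<longleftrightarrow> prob_space M \<and> space M = topspace T \<and>
     sets M = sets (borel_of_top T) \<and>
     (\<forall>A \<in> sets M. \<forall>x \<in> carrier G.
        emeasure M ((\<lambda>y. x \<otimes>\<^bsub>G\<^esub> y) ` A) = emeasure M A)"

definition cont_aut :: "univ monoid \<Rightarrow> univ topology \<Rightarrow> (univ \<Rightarrow> univ) \<Rightarrow> bool" where
  "cont_aut G T a \<longleftrightarrow> a \<in> hom G G \<and> bij_betw a (carrier G) (carrier G) \<and>
     continuous_map T T a"

definition algebraic_action ::
  "univ monoid \<Rightarrow> univ topology \<Rightarrow> ((int ^ ('d::finite)) \<Rightarrow> univ \<Rightarrow> univ) \<Rightarrow> bool" where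
  "algebraic_action G T \<alpha> \<longleftrightarrow>
     (\<forall>n. cont_aut G T (\<alpha> n)) \<and>
     (\<forall>x \<in> carrier G. \<alpha> 0 x = x) \<and>
     (\<forall>m n. \<forall>x \<in> carrier G. \<alpha> (m + n) x = \<alpha> m (\<alpha> n x))"

definition mixing_action ::
  "univ measure \<Rightarrow> ((int ^ ('d::finite)) \<Rightarrow> univ \<Rightarrow> univ) \<Rightarrow> bool" where
  "mixing_action M \<alpha> \<longleftrightarrow>
     (\<forall>A \<in> sets M. \<forall>B \<in> sets M.
        ((\<lambda>n. measure M (A \<inter> (\<alpha> n -` B \<inter> space M)))
           \<longlongrightarrow> measure M A * measure M B) cofinite)"

definition finite_meas_partition :: "'a measure \<Rightarrow> 'a set set \<Rightarrow> bool" where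
  "finite_meas_partition M P \<longleftrightarrow> finite P \<and> P \<subseteq> sets M \<and>
     disjoint P \<and> \<Union>P = space M"

definition part_entropy :: "'a measure \<Rightarrow> 'a set set \<Rightarrow> real" where
  "part_entropy M P = - (\<Sum>A\<in>P. measure M A * ln (measure M A))"

definition join_partition ::
  "'a measure \<Rightarrow> ('i \<Rightarrow> 'a \<Rightarrow> 'a) \<Rightarrow> 'a set set \<Rightarrow> 'i set \<Rightarrow> 'a set set" where
  "join_partition M \<alpha> P F =
     {space M \<inter> (\<Inter>n\<in>F. \<alpha> n -` c n) | c. \<forall>n\<in>F. c n \<in> P}"

definition cube :: "nat \<Rightarrow> (int ^ ('d::finite)) set" where
  "cube k = {v. \<forall>i. 0 \<le> v $ i \<and> v $ i < int k}"

text \<open>Kolmogorov--Sinai entropy of the Z^d action (the limit along cubes exists;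
  we write limsup).\<close>
definition zd_entropy ::
  "univ measure \<Rightarrow> ((int ^ ('d::finite)) \<Rightarrow> univ \<Rightarrow> univ) \<Rightarrow> ereal" where
  "zd_entropy M \<alpha> =
     (SUP P \<in> {P. finite_meas_partition M P}.
        limsup (\<lambda>k. ereal (part_entropy M (join_partition M \<alpha> P (cube k))
                             / real (card (cube k :: (int ^ 'd) set)))))"

definition measure_preserving_map :: "'a measure \<Rightarrow> ('a \<Rightarrow> 'a) \<Rightarrow> bool" where
  "measure_preserving_map M f \<longleftrightarrow> f \<in> measurable M M \<and>
     (\<forall>A \<in> sets M. emeasure M (f -` A \<inter> space M) = emeasure M A)"

definition affine_map ::
  "univ monoid \<Rightarrow> univ topology \<Rightarrow> univ measure \<Rightarrow> (univ \<Rightarrow> univ) \<Rightarrow> bool" where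
  "affine_map G T M f \<longleftrightarrow>
     (\<exists>c \<in> carrier G. \<exists>\<theta>. \<theta> \<in> hom G G \<and> continuous_map T T \<theta> \<and>
        \<theta> ` carrier G = carrier G \<and>
        (AE x in M. f x = c \<otimes>\<^bsub>G\<^esub> \<theta> x))"

end

theory Submission
  imports Defs "HOL-Computational_Algebra.Polynomial_Factorial" "HOL-Library.Z2"
begin

text \<open>Let \<open>K\<close> be the field of rational functions in one variable over the field with two elements,
  choose pairwise coprime nonconstant polynomials \<open>u\<^sub>1, \<dots>, u\<^sub>d\<close> and let the lattice act on \<open>K\<close> through
  multiplication by the monomials \<open>u\<^sup>n\<close>. Let \<open>X\<close> be the group of pairs of an additive functional \<open>x\<close> and
  a biadditive form \<open>y\<close> on \<open>K\<close>, that is, the dual of \<open>K \<oplus> K \<otimes> K\<close>, with the dual action. The map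
  \<open>(x, y) \<mapsto> (x, y + x \<otimes> x)\<close> is an equivariant homeomorphism which is quadratic and not affine. The
  action is mixing because the \<open>u\<^sub>i\<close> are multiplicatively independent, so that no nontrivial character
  has a nontrivial stabilizer. It has zero entropy because the translates of a finite subset of
  \<open>K \<oplus> K \<otimes> K\<close> over a cube of side \<open>k\<close> span a space of dimension \<open>O(k\<^sup>2)\<close>, whereas the cube has \<open>k\<^sup>d\<close>
  points. In coordinates with respect to a basis of \<open>K\<close>, the group \<open>X\<close> is the Cantor group of all
  subsets of the natural numbers under symmetric difference.\<close>

section \<open>The Cantor group and its Haar measure\<close>

text \<open>The tensor product is over the field with two elements, and \<open>u^n\<close> acts on
  both factors at once: moving \<open>x\<close> by \<open>u^n\<close> moves
  \<open>x \<otimes> x\<close> by \<open>u^n \<otimes> u^n\<close>, which makes the quadratic map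
  equivariant. Two demands pull against each other. Zero entropy wants translates that overlap
  heavily, so all \<open>d\<close> generators are taken inside a field of rational functions in one
  variable, where numerator degrees over a cube grow only linearly in its side; the second tensor
  factor squares this. Mixing wants no overlap in the long run, so the generators must be
  multiplicatively independent. A field is convenient because its nonzero elements are invertible
  (the lattice acts by automorphisms) and can be cancelled. In characteristic two the quadratic map
  is its own inverse, so one triangularity property yields both the homeomorphism and the invariance
  of the measure. Characters of \<open>X\<close> are finite sets of coordinates, so statements on
  Haar measure become integrals of signs. The entropy supremum over all partitions is treated
  directly: any partition is nearly a function of finitely many coordinates, and rare errors cost
  little per lattice point.\<close>

definition sdiff :: "'a set \<Rightarrow> 'a set \<Rightarrow> 'a set" (infixl "\<oplus>\<^sub>s" 65) where
  "x \<oplus>\<^sub>s y = {i. (i \<in> x) \<noteq> (i \<in> y)}"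

lemma mem_sdiff [simp]: "i \<in> x \<oplus>\<^sub>s y \<longleftrightarrow> (i \<in> x) \<noteq> (i \<in> y)"
  by (simp add: sdiff_def)

lemma sdiff_assoc: "x \<oplus>\<^sub>s y \<oplus>\<^sub>s z = x \<oplus>\<^sub>s (y \<oplus>\<^sub>s z)"
  and sdiff_commute: "x \<oplus>\<^sub>s y = y \<oplus>\<^sub>s x"
  and sdiff_self [simp]: "x \<oplus>\<^sub>s x = {}"
  and sdiff_empty [simp]: "x \<oplus>\<^sub>s {} = x" "{} \<oplus>\<^sub>s x = x"
  and sdiff_cancel [simp]: "x \<oplus>\<^sub>s (x \<oplus>\<^sub>s y) = y"
  and sdiff_eq_empty [simp]: "x \<oplus>\<^sub>s y = {} \<longleftrightarrow> x = y"
  by auto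

lemma finite_sdiff [intro]: "finite x \<Longrightarrow> finite y \<Longrightarrow> finite (x \<oplus>\<^sub>s y)"
  by (rule finite_subset[of _ "x \<union> y"]) auto

text \<open>The bilinear form over the field with two elements. Finite \<open>v\<close> are exactly
  the characters of the Cantor group; an infinite intersection has \<open>card\<close> 0, so
  additivity is claimed only for finite \<open>v\<close>.\<close>

definition pairing :: "'a set \<Rightarrow> 'a set \<Rightarrow> bool" where
  "pairing x v \<longleftrightarrow> odd (card (x \<inter> v))"

lemma odd_card_sdiff:
  assumes "finite A" "finite B"
  shows "odd (card (A \<oplus>\<^sub>s B)) \<longleftrightarrow> odd (card A) \<noteq> odd (card B)"
proof -
  have "A \<oplus>\<^sub>s B = (A - B) \<union> (B - A)" by auto
  then have "card (A \<oplus>\<^sub>s B) = card (A - B) + card (B - A)"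
    using assms by (simp only:) (rule card_Un_disjoint; auto)
  moreover have "card A = card (A - B) + card (A \<inter> B)" "card B = card (B - A) + card (A \<inter> B)"
    using assms by (metis card_Diff_subset_Int card_mono finite_Int inf.commute inf_le1 le_add_diff_inverse2)+
  ultimately show ?thesis by presburger
qed

lemma pairing_sdiff_right:
  assumes "finite v" "finite w"
  shows "pairing x (v \<oplus>\<^sub>s w) \<longleftrightarrow> pairing x v \<noteq> pairing x w"
proof -
  have "x \<inter> (v \<oplus>\<^sub>s w) = (x \<inter> v) \<oplus>\<^sub>s (x \<inter> w)" by auto
  then show ?thesis using assms by (simp add: pairing_def odd_card_sdiff)
qed

lemma pairing_sdiff_left:
  assumes "finite v"
  shows "pairing (x \<oplus>\<^sub>s y) v \<longleftrightarrow> pairing x v \<noteq> pairing y v"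
proof -
  have "(x \<oplus>\<^sub>s y) \<inter> v = (x \<inter> v) \<oplus>\<^sub>s (y \<inter> v)" by auto
  then show ?thesis using assms by (simp add: pairing_def odd_card_sdiff)
qed

lemma pairing_empty [simp]: "\<not> pairing x {}" "\<not> pairing {} v"
  by (auto simp: pairing_def)

lemma pairing_singleton [simp]: "pairing x {i} \<longleftrightarrow> i \<in> x" "pairing {i} v \<longleftrightarrow> i \<in> v"
  by (cases "i \<in> x"; simp add: pairing_def) (cases "i \<in> v"; simp add: pairing_def)

lemma pairing_insert:
  assumes "finite v" "i \<notin> v"
  shows "pairing x (insert i v) \<longleftrightarrow> (i \<in> x) \<noteq> pairing x v"
proof -
  have "insert i v = {i} \<oplus>\<^sub>s v" using assms(2) by auto
  then show ?thesis using assms by (simp add: pairing_sdiff_right)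
qed

lemma pairing_cong: "x \<inter> v = y \<inter> v \<Longrightarrow> pairing x v = pairing y v"
  by (simp add: pairing_def)

lemma pairing_image:
  assumes "inj h"
  shows "pairing x (h ` v) \<longleftrightarrow> pairing (h -` x) v"
proof -
  have "x \<inter> h ` v = h ` (h -` x \<inter> v)" by auto
  then show ?thesis using assms by (simp add: pairing_def card_image inj_on_subset)
qed

text \<open>Parity is multiplicative, so pure tensors pair to the product of the two
  pairings.\<close>

lemma pairing_Times: "pairing (x \<times> y) (v \<times> w) \<longleftrightarrow> pairing x v \<and> pairing y w"
  by (simp add: pairing_def Times_Int_Times card_cartesian_product)

section \<open>Topology and group structure of the Cantor group\<close>

definition cantor_topology :: "nat set topology" where
  "cantor_topology =
     topology (\<lambda>U. \<forall>x\<in>U. \<exists>k. \<forall>y. y \<inter> {..<k} = x \<inter> {..<k} \<longrightarrow> y \<in> U)"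

lemma agree_mono:
  fixes x y :: "nat set"
  assumes "y \<inter> {..<l} = x \<inter> {..<l}" "k \<le> l"
  shows "y \<inter> {..<k} = x \<inter> {..<k}"
proof -
  have "{..<k} = {..<l} \<inter> {..<k}" using assms(2) by auto
  then show ?thesis using assms(1) by (metis inf_assoc)
qed

lemma openin_cantor:
  "openin cantor_topology U \<longleftrightarrow>
     (\<forall>x\<in>U. \<exists>k. \<forall>y. y \<inter> {..<k} = x \<inter> {..<k} \<longrightarrow> y \<in> U)"
proof -
  let ?L = "\<lambda>U::nat set set. \<forall>x\<in>U. \<exists>k. \<forall>y. y \<inter> {..<k} = x \<inter> {..<k} \<longrightarrow> y \<in> U"
  have "istopology ?L"
    unfolding istopology_def
  proof (intro conjI allI impI)
    fix S T assume S: "?L S" and T: "?L T"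
    show "?L (S \<inter> T)"
    proof
      fix x assume "x \<in> S \<inter> T"
      then have x: "x \<in> S" "x \<in> T" by auto
      obtain k where k: "\<forall>y. y \<inter> {..<k} = x \<inter> {..<k} \<longrightarrow> y \<in> S" using bspec[OF S x(1)] ..
      obtain l where l: "\<forall>y. y \<inter> {..<l} = x \<inter> {..<l} \<longrightarrow> y \<in> T" using bspec[OF T x(2)] ..
      have "\<forall>y. y \<inter> {..<max k l} = x \<inter> {..<max k l} \<longrightarrow> y \<in> S \<inter> T"
      proof (intro allI impI IntI)
        fix y assume *: "y \<inter> {..<max k l} = x \<inter> {..<max k l}"
        show "y \<in> S" using k agree_mono[OF *, of k] by simp
        show "y \<in> T" using l agree_mono[OF *, of l] by simp
      qed
      then show "\<exists>k. \<forall>y. y \<inter> {..<k} = x \<inter> {..<k} \<longrightarrow> y \<in> S \<inter> T" ..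
    qed
  next
    fix \<K> assume \<K>: "\<forall>K\<in>\<K>. ?L K"
    show "?L (\<Union>\<K>)"
    proof
      fix x assume "x \<in> \<Union>\<K>"
      then obtain K where K: "K \<in> \<K>" "x \<in> K" ..
      obtain k where "\<forall>y. y \<inter> {..<k} = x \<inter> {..<k} \<longrightarrow> y \<in> K"
        using bspec[OF bspec[OF \<K> K(1)] K(2)] ..
      then show "\<exists>k. \<forall>y. y \<inter> {..<k} = x \<inter> {..<k} \<longrightarrow> y \<in> \<Union>\<K>"
        using K(1) by (intro exI[of _ k]) blast
    qed
  qed
  then show ?thesis by (simp add: cantor_topology_def topology_inverse')
qed

lemma openin_cantorE:
  assumes "openin cantor_topology U" "x \<in> U"
  obtains k where "\<And>y. y \<inter> {..<k} = x \<inter> {..<k} \<Longrightarrow> y \<in> U"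
  using assms unfolding openin_cantor by meson

lemma topspace_cantor [simp]: "topspace cantor_topology = UNIV"
  by (metis UNIV_I openin_cantor openin_subset top.extremum_uniqueI)

text \<open>Members of \<open>C\<close> that are not subsets of \<open>{..<k}\<close> have no
  effect, whence the recurring \<open>C \<inter> Pow {..<k}\<close>.\<close>

definition cylinder :: "nat \<Rightarrow> nat set set \<Rightarrow> nat set set" where
  "cylinder k C = {x. x \<inter> {..<k} \<in> C}"

lemma mem_cylinder [simp]: "x \<in> cylinder k C \<longleftrightarrow> x \<inter> {..<k} \<in> C"
  by (simp add: cylinder_def)

lemma openin_cylinder: "openin cantor_topology (cylinder k C)"
  unfolding openin_cantor by (metis mem_cylinder)

lemma closedin_cylinder: "closedin cantor_topology (cylinder k C)"
proof -
  have "UNIV - cylinder k C = cylinder k (- C)" by auto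
  then show ?thesis using openin_cylinder by (simp add: closedin_def)
qed

text \<open>The length \<open>l\<close> is uniform in the point, a modulus of continuity;
  translations, dual maps and the shear all come with one.\<close>

lemma continuous_map_cantor:
  assumes "\<And>k. \<exists>l. \<forall>x y. y \<inter> {..<l} = x \<inter> {..<l} \<longrightarrow> f y \<inter> {..<k} = f x \<inter> {..<k}"
  shows "continuous_map cantor_topology cantor_topology f"
  unfolding continuous_map_def
proof (intro conjI allI impI)
  fix U assume U: "openin cantor_topology U"
  show "openin cantor_topology {x \<in> topspace cantor_topology. f x \<in> U}"
    unfolding openin_cantor
  proof
    fix x assume "x \<in> {x \<in> topspace cantor_topology. f x \<in> U}"
    then obtain k where k: "\<And>y. y \<inter> {..<k} = f x \<inter> {..<k} \<Longrightarrow> y \<in> U"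
      using openin_cantorE[OF U] by (metis (mono_tags, lifting) mem_Collect_eq)
    obtain l where "\<forall>x y. y \<inter> {..<l} = x \<inter> {..<l} \<longrightarrow> f y \<inter> {..<k} = f x \<inter> {..<k}"
      using assms by blast
    then show "\<exists>k. \<forall>y. y \<inter> {..<k} = x \<inter> {..<k} \<longrightarrow> y \<in> {x \<in> topspace cantor_topology. f x \<in> U}"
      using k by (metis (mono_tags, lifting) UNIV_I mem_Collect_eq topspace_cantor)
  qed
qed auto

text \<open>Tychonoff's theorem for sequences of booleans, carried over by the continuous surjection
  \<open>Collect\<close>.\<close>

lemma compact_space_cantor: "compact_space cantor_topology"
proof -
  let ?P = "product_topology (\<lambda>_. discrete_topology UNIV) UNIV :: (nat \<Rightarrow> bool) topology"
  have "continuous_map ?P cantor_topology Collect"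
    unfolding continuous_map_def
  proof (intro conjI allI impI)
    fix U assume U: "openin cantor_topology U"
    show "openin ?P {x \<in> topspace ?P. Collect x \<in> U}"
      unfolding openin_product_topology_alt
    proof
      fix w assume "w \<in> {x \<in> topspace ?P. Collect x \<in> U}"
      then obtain k where k: "\<And>y. y \<inter> {..<k} = Collect w \<inter> {..<k} \<Longrightarrow> y \<in> U"
        using openin_cantorE[OF U] by (metis (mono_tags, lifting) mem_Collect_eq)
      define V where "V i = (if i < k then {w i} else UNIV)" for i
      have "finite {i \<in> UNIV. V i \<noteq> topspace (discrete_topology UNIV)}"
        by (rule finite_subset[of _ "{..<k}"]) (auto simp: V_def)
      moreover have "y \<in> {x \<in> topspace ?P. Collect x \<in> U}" if "y \<in> Pi\<^sub>E UNIV V" for y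
      proof -
        have "y i = w i" if "i < k" for i using PiE_mem[OF \<open>y \<in> Pi\<^sub>E UNIV V\<close>, of i] that
          by (simp add: V_def)
        then have "Collect y \<inter> {..<k} = Collect w \<inter> {..<k}" by auto
        then show ?thesis using k by simp
      qed
      moreover have "w \<in> Pi\<^sub>E UNIV V" by (auto simp: V_def PiE_iff)
      ultimately show "\<exists>V. finite {i \<in> UNIV. V i \<noteq> topspace (discrete_topology UNIV)} \<and>
          (\<forall>i\<in>UNIV. openin (discrete_topology UNIV) (V i)) \<and> w \<in> Pi\<^sub>E UNIV V \<and>
          Pi\<^sub>E UNIV V \<subseteq> {x \<in> topspace ?P. Collect x \<in> U}"
        by (intro exI[of _ V]) auto
    qed
  qed auto
  moreover have "compact_space ?P"
    by (simp add: compact_space_product_topology compact_space_discrete_topology)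
  ultimately have "compactin cantor_topology (Collect ` topspace ?P)"
    using image_compactin by (metis compact_space_def)
  moreover have "Collect ` topspace ?P = UNIV"
    by (simp add: surj_def) (metis Collect_mem_eq)
  ultimately show ?thesis by (simp add: compact_space_def)
qed

definition cantor_group :: "nat set monoid" where
  "cantor_group = \<lparr>carrier = UNIV, mult = (\<oplus>\<^sub>s), one = {}\<rparr>"

lemma cantor_group_simps [simp]:
  "carrier cantor_group = UNIV" "x \<otimes>\<^bsub>cantor_group\<^esub> y = x \<oplus>\<^sub>s y" "\<one>\<^bsub>cantor_group\<^esub> = {}"
  by (simp_all add: cantor_group_def)

lemma comm_group_cantor: "comm_group cantor_group"
proof (rule comm_groupI)
  fix x assume "x \<in> carrier cantor_group"
  show "\<exists>y\<in>carrier cantor_group. y \<otimes>\<^bsub>cantor_group\<^esub> x = \<one>\<^bsub>cantor_group\<^esub>"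
    by (intro bexI[of _ x]) simp_all
qed (auto simp: sdiff_assoc intro: sdiff_commute)

lemma inv_cantor_group [simp]: "inv\<^bsub>cantor_group\<^esub> x = x"
  using comm_group.axioms(2)[OF comm_group_cantor]
  by (intro group.inv_equality) auto

text \<open>Cylinders do all the work: points that differ at \<open>i\<close> are separated by
  cylinders of length \<open>Suc i\<close>, clopen cylinders form a neighbourhood base and so give
  dimension 0, and addition respects agreement on initial segments.\<close>

lemma compact_zd_abelian_group_cantor: "compact_zd_abelian_group cantor_group cantor_topology"
  unfolding compact_zd_abelian_group_def
proof (intro conjI)
  show "Hausdorff_space cantor_topology"
    unfolding Hausdorff_space_def
  proof (intro allI impI)
    fix x y assume "x \<in> topspace cantor_topology \<and> y \<in> topspace cantor_topology \<and> x \<noteq> y"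
    then obtain i where "(i \<in> x) \<noteq> (i \<in> y)" by blast
    then have "x \<inter> {..<Suc i} \<noteq> y \<inter> {..<Suc i}" by blast
    then have "disjnt (cylinder (Suc i) {x \<inter> {..<Suc i}}) (cylinder (Suc i) {y \<inter> {..<Suc i}})"
      unfolding disjnt_iff mem_cylinder singleton_iff by metis
    then show "\<exists>U V. openin cantor_topology U \<and> openin cantor_topology V \<and> x \<in> U \<and> y \<in> V \<and> disjnt U V"
      by (intro exI[of _ "cylinder (Suc i) {x \<inter> {..<Suc i}}"] exI[of _ "cylinder (Suc i) {y \<inter> {..<Suc i}}"])
        (simp only: openin_cylinder mem_cylinder singleton_iff simp_thms)
  qed
  have "\<exists>V. a \<in> V \<and> V \<subseteq> W \<and> closedin cantor_topology V \<and> openin cantor_topology V"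
    if W: "openin cantor_topology W" "a \<in> W" for W a
  proof -
    obtain k where "\<And>y. y \<inter> {..<k} = a \<inter> {..<k} \<Longrightarrow> y \<in> W"
      using openin_cantorE[OF W] by metis
    then have "cylinder k {a \<inter> {..<k}} \<subseteq> W" by (meson mem_cylinder singletonD subsetI)
    then show ?thesis
      by (intro exI[of _ "cylinder k {a \<inter> {..<k}}"]) (simp add: openin_cylinder closedin_cylinder)
  qed
  then show "cantor_topology dim_le 0"
    unfolding dimension_le_0_neighbourhood_base_of_clopen
    by (subst open_neighbourhood_base_of) (auto, blast)
  show "continuous_map (prod_topology cantor_topology cantor_topology) cantor_topology
     (\<lambda>(x, y). x \<otimes>\<^bsub>cantor_group\<^esub> y)"
    unfolding continuous_map_def
  proof (intro conjI allI impI)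
    fix U assume U: "openin cantor_topology U"
    show "openin (prod_topology cantor_topology cantor_topology)
       {x \<in> topspace (prod_topology cantor_topology cantor_topology).
         (case x of (x, y) \<Rightarrow> x \<otimes>\<^bsub>cantor_group\<^esub> y) \<in> U}"
      unfolding openin_prod_topology_alt
    proof (intro allI impI)
      fix x y assume "(x, y) \<in> {x \<in> topspace (prod_topology cantor_topology cantor_topology).
         (case x of (x, y) \<Rightarrow> x \<otimes>\<^bsub>cantor_group\<^esub> y) \<in> U}"
      then have "x \<oplus>\<^sub>s y \<in> U" by simp
      then obtain k where k: "\<And>z. z \<inter> {..<k} = (x \<oplus>\<^sub>s y) \<inter> {..<k} \<Longrightarrow> z \<in> U"
        using openin_cantorE[OF U] by metis
      have "x' \<oplus>\<^sub>s y' \<in> U" if "x' \<inter> {..<k} = x \<inter> {..<k}" "y' \<inter> {..<k} = y \<inter> {..<k}" for x' y'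
      proof (rule k)
        have "(x' \<oplus>\<^sub>s y') \<inter> {..<k} = (x' \<inter> {..<k}) \<oplus>\<^sub>s (y' \<inter> {..<k})" by auto
        also have "\<dots> = (x \<oplus>\<^sub>s y) \<inter> {..<k}" unfolding that by auto
        finally show "(x' \<oplus>\<^sub>s y') \<inter> {..<k} = (x \<oplus>\<^sub>s y) \<inter> {..<k}" .
      qed
      then show "\<exists>V W. openin cantor_topology V \<and> openin cantor_topology W \<and> x \<in> V \<and> y \<in> W \<and>
         V \<times> W \<subseteq> {x \<in> topspace (prod_topology cantor_topology cantor_topology).
           (case x of (x, y) \<Rightarrow> x \<otimes>\<^bsub>cantor_group\<^esub> y) \<in> U}"
        by (intro exI[of _ "cylinder k {x \<inter> {..<k}}"] exI[of _ "cylinder k {y \<inter> {..<k}}"])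
          (simp add: openin_cylinder subset_iff)
    qed
  qed auto
  have "(\<lambda>x. inv\<^bsub>cantor_group\<^esub> x) = id" by auto
  then show "continuous_map cantor_topology cantor_topology (\<lambda>x. inv\<^bsub>cantor_group\<^esub> x)"
    by simp
qed (auto simp: comm_group_cantor compact_space_cantor)

section \<open>Borel sets, and Haar measure as fair coin tossing\<close>

definition cantor_borel :: "nat set measure" where
  "cantor_borel = borel_of_top cantor_topology"

lemma space_cantor_borel [simp]: "space cantor_borel = UNIV"
  by (simp add: cantor_borel_def borel_of_top_def)

lemma sets_sdiff [measurable (raw)]: "A \<in> sets M \<Longrightarrow> B \<in> sets M \<Longrightarrow> A \<oplus>\<^sub>s B \<in> sets M"
proof -
  assume "A \<in> sets M" "B \<in> sets M"
  moreover have "A \<oplus>\<^sub>s B = (A - B) \<union> (B - A)" by auto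
  ultimately show ?thesis by auto
qed

lemma openin_sets_cantor_borel: "openin cantor_topology U \<Longrightarrow> U \<in> sets cantor_borel"
  by (simp add: cantor_borel_def borel_of_top_def)

lemma cylinder_sets [measurable]: "cylinder k C \<in> sets cantor_borel"
  by (intro openin_sets_cantor_borel openin_cylinder)

definition cylinders :: "nat set set set" where
  "cylinders = (\<Union>k. \<Union>C. {cylinder k C})"

text \<open>At each length take the prefixes all of whose extensions stay in \<open>U\<close>. The
  union is countable, which is what lets cylinders generate the Borel sets.\<close>

lemma open_as_Union_cylinders:
  assumes "openin cantor_topology U"
  shows "U = (\<Union>k. cylinder k {c. \<forall>y. y \<inter> {..<k} = c \<longrightarrow> y \<in> U})"
proof (intro equalityI subsetI)
  fix x assume "x \<in> U"
  then show "x \<in> (\<Union>k. cylinder k {c. \<forall>y. y \<inter> {..<k} = c \<longrightarrow> y \<in> U})"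
    using assms unfolding openin_cantor by simp
qed auto

lemma sets_cantor_borel: "sets cantor_borel = sigma_sets UNIV cylinders"
proof -
  have "sigma_sets UNIV {U. openin cantor_topology U} = sigma_sets UNIV cylinders"
  proof (rule sigma_sets_eqI)
    fix U assume "U \<in> {U. openin cantor_topology U}"
    then have "U = (\<Union>k. cylinder k {c. \<forall>y. y \<inter> {..<k} = c \<longrightarrow> y \<in> U})"
      using open_as_Union_cylinders by blast
    moreover have "(\<Union>k. cylinder k {c. \<forall>y. y \<inter> {..<k} = c \<longrightarrow> y \<in> U}) \<in> sigma_sets UNIV cylinders"
      by (intro sigma_sets_UNION) (auto simp: cylinders_def)
    ultimately show "U \<in> sigma_sets UNIV cylinders" by simp
  qed (auto simp: cylinders_def openin_cylinder)
  then show ?thesis by (simp add: cantor_borel_def borel_of_top_def)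
qed

lemma cylinder_lift: "k \<le> l \<Longrightarrow> cylinder k C = cylinder l {c. c \<inter> {..<k} \<in> C}"
proof -
  assume "k \<le> l"
  then have eq: "{..<l} \<inter> {..<k} = {..<k}" by auto
  show ?thesis
    by (rule Set.set_eqI) (simp only: mem_cylinder mem_Collect_eq Int_assoc eq)
qed

lemma cylinder_atoms: "cylinder k C = (\<Union>c\<in>C \<inter> Pow {..<k}. cylinder k {c})"
  by auto

lemma Int_stable_cylinders: "Int_stable cylinders"
  unfolding Int_stable_def
proof (intro ballI)
  fix A B assume "A \<in> cylinders" "B \<in> cylinders"
  then obtain k C l D where A: "A = cylinder k C" and B: "B = cylinder l D"
    by (auto simp: cylinders_def)
  have "A = cylinder (max k l) {c. c \<inter> {..<k} \<in> C}" "B = cylinder (max k l) {c. c \<inter> {..<l} \<in> D}"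
    unfolding A B by (rule cylinder_lift, simp)+
  then have "A \<inter> B = cylinder (max k l) ({c. c \<inter> {..<k} \<in> C} \<inter> {c. c \<inter> {..<l} \<in> D})"
    by auto
  then show "A \<inter> B \<in> cylinders" by (auto simp: cylinders_def)
qed

lemma measurable_cantor:
  assumes "\<And>k. \<exists>l. \<forall>x y. y \<inter> {..<l} = x \<inter> {..<l} \<longrightarrow> f y \<inter> {..<k} = f x \<inter> {..<k}"
  shows "f \<in> measurable cantor_borel cantor_borel"
proof -
  have "f \<in> measurable cantor_borel (sigma UNIV {U. openin cantor_topology U})"
  proof (rule measurable_measure_of)
    fix U assume "U \<in> {U. openin cantor_topology U}"
    then have "openin cantor_topology {x \<in> topspace cantor_topology. f x \<in> U}"
      using continuous_map_cantor[OF assms] by (intro openin_continuous_map_preimage) auto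
    then show "f -` U \<inter> space cantor_borel \<in> sets cantor_borel"
      by (intro openin_sets_cantor_borel) (simp add: vimage_def)
  qed auto
  moreover have "sigma UNIV {U. openin cantor_topology U} = cantor_borel"
    by (simp add: cantor_borel_def borel_of_top_def)
  ultimately show ?thesis by simp
qed

definition coin_measure :: "nat set measure" where
  "coin_measure = distr (PiM UNIV (\<lambda>_::nat. measure_pmf (bernoulli_pmf (1/2)))) cantor_borel Collect"

lemma Collect_Int_eq_iff:
  "c \<subseteq> {..<k} \<Longrightarrow> Collect w \<inter> {..<k} = c \<longleftrightarrow> (\<forall>i\<in>{..<k::nat}. w i \<in> {i \<in> c})"
  by auto

lemma Collect_measurable_coin:
  "Collect \<in> measurable (PiM UNIV (\<lambda>_::nat. measure_pmf (bernoulli_pmf (1/2)))) cantor_borel"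
proof -
  let ?P = "PiM UNIV (\<lambda>_::nat. measure_pmf (bernoulli_pmf (1/2)))"
  have "Collect \<in> measurable ?P (sigma UNIV cylinders)"
  proof (rule measurable_measure_of)
    fix A assume "A \<in> cylinders"
    then obtain k C where A: "A = cylinder k C" by (auto simp: cylinders_def)
    have "Collect -` A \<inter> space ?P =
        (\<Union>c\<in>C \<inter> Pow {..<k}. {w \<in> space ?P. \<forall>i\<in>{..<k}. w i \<in> {i \<in> c}})"
      unfolding A by (subst cylinder_atoms) (auto simp: vimage_def Collect_Int_eq_iff simp del: singleton_iff)
    also have "\<dots> \<in> sets ?P"
    proof (intro sets.finite_UN)
      fix c
      have "{w \<in> space ?P. w i \<in> B} \<in> sets ?P" for i B
        using measurable_sets[OF measurable_component_singleton[of i UNIV "\<lambda>_. measure_pmf (bernoulli_pmf (1/2))"], of B]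
        by (simp add: vimage_def Int_def conj_commute)
      then show "{w \<in> space ?P. \<forall>i\<in>{..<k}. w i \<in> {i \<in> c}} \<in> sets ?P"
        by (intro sets.sets_Collect_finite_All) auto
    qed auto
    finally show "Collect -` A \<inter> space ?P \<in> sets ?P" .
  qed auto
  moreover have "sets (sigma UNIV cylinders) = sets cantor_borel" by (simp add: sets_cantor_borel)
  ultimately show ?thesis using measurable_cong_sets by blast
qed

lemma sets_coin [simp, measurable_cong]: "sets coin_measure = sets cantor_borel"
  and space_coin [simp]: "space coin_measure = UNIV"
  by (simp_all add: coin_measure_def)

interpretation coin: prob_space coin_measure
  unfolding coin_measure_def
  by (intro prob_space.prob_space_distr prob_space_PiM Collect_measurable_coin)
    (rule measure_pmf.prob_space_axioms)

lemma emeasure_coin_atom: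
  assumes "c \<subseteq> {..<k}"
  shows "emeasure coin_measure (cylinder k {c}) = ennreal ((1/2)^k)"
proof -
  let ?P = "PiM UNIV (\<lambda>_::nat. measure_pmf (bernoulli_pmf (1/2)))"
  interpret product_prob_space "\<lambda>_::nat. measure_pmf (bernoulli_pmf (1/2))" UNIV
    by standard
  have "Collect -` cylinder k {c} \<inter> space ?P = {w \<in> space ?P. \<forall>i\<in>{..<k}. w i \<in> {i \<in> c}}"
    unfolding Collect_Int_eq_iff[OF assms, symmetric] by auto
  then have "emeasure coin_measure (cylinder k {c}) = emeasure ?P {w \<in> space ?P. \<forall>i\<in>{..<k}. w i \<in> {i \<in> c}}"
    unfolding coin_measure_def by (subst emeasure_distr[OF Collect_measurable_coin]) auto
  also have "\<dots> = (\<Prod>i<k. emeasure (measure_pmf (bernoulli_pmf (1/2))) {i \<in> c})"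
    by (rule emeasure_PiM_Collect) auto
  also have "\<dots> = (\<Prod>i<k. ennreal (1/2))"
    by (intro prod.cong) (auto simp: emeasure_pmf_single)
  also have "\<dots> = ennreal ((1/2)^k)" by (subst prod_constant, subst ennreal_power) simp_all
  finally show ?thesis .
qed

lemma measure_coin_atom: "c \<subseteq> {..<k} \<Longrightarrow> measure coin_measure (cylinder k {c}) = (1/2)^k"
  by (simp add: measure_def emeasure_coin_atom)

text \<open>Uniqueness on an intersection-stable generator: every cylinder is a finite disjoint
  union of atoms, and \<open>UNIV\<close> is the atom of length 0.\<close>

lemma coin_measure_eqI:
  assumes "sets N = sets cantor_borel"
    and "\<And>k c. c \<subseteq> {..<k} \<Longrightarrow> emeasure N (cylinder k {c}) = ennreal ((1/2)^k)"
  shows "N = coin_measure"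
proof (rule measure_eqI_generator_eq[OF Int_stable_cylinders, of UNIV _ _ "\<lambda>_. UNIV"])
  fix A assume "A \<in> cylinders"
  then obtain k C where "A = cylinder k C" by (auto simp: cylinders_def)
  then have A: "A = (\<Union>c\<in>C \<inter> Pow {..<k}. cylinder k {c})"
    using cylinder_atoms[of k C] by simp
  have "emeasure N A = (\<Sum>c\<in>C \<inter> Pow {..<k}. emeasure N (cylinder k {c}))"
    unfolding A using assms(1) by (intro sum_emeasure[symmetric]) (auto simp: disjoint_family_on_def cylinder_sets)
  moreover have "emeasure coin_measure A = (\<Sum>c\<in>C \<inter> Pow {..<k}. emeasure coin_measure (cylinder k {c}))"
    unfolding A by (intro sum_emeasure[symmetric]) (auto simp: disjoint_family_on_def cylinder_sets)
  ultimately show "emeasure N A = emeasure coin_measure A"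
    using assms(2) by (simp add: emeasure_coin_atom)
next
  have "UNIV = cylinder 0 {{}}" by auto
  then have "emeasure N UNIV = ennreal ((1/2)^0)" using assms(2)[of "{}" 0] by simp
  then show "emeasure N UNIV \<noteq> \<infinity>" by simp
  show "range (\<lambda>_. UNIV) \<subseteq> cylinders"
    using \<open>UNIV = cylinder 0 {{}}\<close> by (auto simp: cylinders_def)
qed (use assms(1) in \<open>auto simp: sets_cantor_borel\<close>)

lemma distr_coin_eqI:
  assumes "f \<in> measurable cantor_borel cantor_borel"
    and "\<And>k c. c \<subseteq> {..<k} \<Longrightarrow> measure coin_measure (f -` cylinder k {c}) = (1/2)^k"
  shows "distr coin_measure cantor_borel f = coin_measure"
proof (rule coin_measure_eqI)
  fix k c assume "c \<subseteq> {..<k::nat}"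
  then show "emeasure (distr coin_measure cantor_borel f) (cylinder k {c}) = ennreal ((1/2)^k)"
    using assms by (subst emeasure_distr) (auto simp: coin.emeasure_eq_measure cong: measurable_cong_sets)
qed simp

lemma measure_preserving_coinI:
  assumes "f \<in> measurable cantor_borel cantor_borel"
    and "distr coin_measure cantor_borel f = coin_measure"
  shows "measure_preserving_map coin_measure f"
proof -
  have f: "f \<in> measurable coin_measure cantor_borel"
    using assms(1) by (simp cong: measurable_cong_sets)
  then show ?thesis
    unfolding measure_preserving_map_def
    using emeasure_distr[OF f] assms(2) by (auto cong: measurable_cong_sets)
qed

text \<open>Such a map induces an involution on the prefixes of each length, hence permutes atoms of
  equal measure. Translations and the shear are both of this kind.\<close>

lemma distr_coin_triangular_involution:
  assumes tri: "\<And>k x y. y \<inter> {..<k} = x \<inter> {..<k} \<Longrightarrow> f y \<inter> {..<k} = f x \<inter> {..<k}"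
    and inv: "\<And>x. f (f x) = x"
  shows "distr coin_measure cantor_borel f = coin_measure"
proof (rule distr_coin_eqI)
  show "f \<in> measurable cantor_borel cantor_borel"
    by (rule measurable_cantor) (use tri in blast)
  fix k c assume c: "c \<subseteq> {..<k::nat}"
  have "f x \<inter> {..<k} = c \<longleftrightarrow> x \<inter> {..<k} = f c \<inter> {..<k}" for x
    using tri[of "f x" k c] tri[of x k "f c"] inv c by (metis inf.absorb1)
  then have "f -` cylinder k {c} = cylinder k {f c \<inter> {..<k}}" by auto
  then show "measure coin_measure (f -` cylinder k {c}) = (1/2)^k"
    by (simp add: measure_coin_atom)
qed

lemma distr_coin_translate: "distr coin_measure cantor_borel ((\<oplus>\<^sub>s) z) = coin_measure"
  by (rule distr_coin_triangular_involution) (auto simp: set_eq_iff)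

lemma translate_measurable: "(\<oplus>\<^sub>s) z \<in> measurable cantor_borel cantor_borel"
  by (rule measurable_cantor) (auto simp: set_eq_iff)

lemma is_haar_coin: "is_haar cantor_group cantor_topology coin_measure"
  unfolding is_haar_def
proof (intro conjI ballI)
  fix A x assume A: "A \<in> sets coin_measure"
  \<comment> \<open>Translation by \<open>x\<close> is its own inverse, so its images are its
    preimages.\<close>
  have "(\<lambda>y. x \<otimes>\<^bsub>cantor_group\<^esub> y) ` A = (\<oplus>\<^sub>s) x -` A \<inter> space coin_measure"
    by (auto simp: image_iff) (metis sdiff_cancel)
  then show "emeasure coin_measure ((\<lambda>y. x \<otimes>\<^bsub>cantor_group\<^esub> y) ` A) = emeasure coin_measure A"
    using measure_preserving_coinI[OF translate_measurable distr_coin_translate[of x]] A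
    by (simp add: measure_preserving_map_def)
qed (auto simp: coin.prob_space_axioms cantor_borel_def)

text \<open>The sets that cylinders approximate arbitrarily well contain the cylinders and are
  closed under complement and countable union.\<close>

lemma coin_approx_cylinder:
  assumes "A \<in> sets coin_measure" "e > 0"
  shows "\<exists>k C. measure coin_measure (A \<oplus>\<^sub>s cylinder k C) < e"
proof -
  have "A \<in> sigma_sets UNIV cylinders" using assms(1) by (simp add: sets_cantor_borel)
  then have "A \<in> sets cantor_borel \<and> (\<forall>e>0. \<exists>k C. measure coin_measure (A \<oplus>\<^sub>s cylinder k C) < e)"
  proof (induction rule: sigma_sets.induct)
    case (Basic A)
    then obtain k C where "A = cylinder k C" by (auto simp: cylinders_def)
    then show ?case by (metis cylinder_sets measure_empty sdiff_self)
  next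
    case Empty
    have "{} = cylinder 0 {}" by auto
    then show ?case by (metis cylinder_sets measure_empty sdiff_self)
  next
    case (Compl A)
    have "(UNIV - A) \<oplus>\<^sub>s cylinder k (- C) = A \<oplus>\<^sub>s cylinder k C" for k C by auto
    then show ?case using Compl by (metis sets.compl_sets space_cantor_borel)
  next
    case (Union A)
    then have sA [measurable]: "A i \<in> sets cantor_borel" for i by blast
    define B where "B n = (\<Union>i<n. A i)" for n
    have [measurable]: "B n \<in> sets cantor_borel" "(\<Union>i. A i) \<in> sets cantor_borel" for n
      by (auto simp: B_def)
    have "\<exists>k C. measure coin_measure ((\<Union>i. A i) \<oplus>\<^sub>s cylinder k C) < e" if "e > 0" for e
    proof -
      have "(\<lambda>n. measure coin_measure (B n)) \<longlonglongrightarrow> measure coin_measure (\<Union>n. B n)"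
        by (rule coin.finite_Lim_measure_incseq) (auto simp: incseq_def B_def intro: less_le_trans)
      moreover have "(\<Union>n. B n) = (\<Union>i. A i)" by (auto simp: B_def)
      ultimately have "\<forall>\<^sub>F n in sequentially. measure coin_measure (B n) > measure coin_measure (\<Union>i. A i) - e/2"
        using that by (intro order_tendstoD(1)[where y = "measure coin_measure (\<Union>i. A i)"]) auto
      then obtain n where n: "measure coin_measure (B n) > measure coin_measure (\<Union>i. A i) - e/2"
        by (meson eventually_sequentially order_refl)
      \<comment> \<open>Truncating the union costs half of \<open>e\<close>; the other half is
        shared among \<open>n\<close> sets, with \<open>n + 1\<close> in place of \<open>n\<close>
        to cover the case \<open>n = 0\<close>.\<close>
      have "\<exists>k C. measure coin_measure (A i \<oplus>\<^sub>s cylinder k C) < e / (2 * (real n + 1))" for i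
        using Union that by simp
      then obtain k C where kC: "\<And>i. measure coin_measure (A i \<oplus>\<^sub>s cylinder (k i) (C i)) < e / (2 * (real n + 1))"
        by metis
      define l where "l = (\<Sum>i<n. k i)"
      have kl: "k i \<le> l" if "i < n" for i using that unfolding l_def by (intro member_le_sum) auto
      define D where "D = (\<Union>i<n. {c. c \<inter> {..<k i} \<in> C i})"
      have D: "cylinder l D = (\<Union>i<n. cylinder (k i) (C i))"
      proof -
        have "cylinder l D = (\<Union>i<n. cylinder l {c. c \<inter> {..<k i} \<in> C i})"
          by (auto simp: D_def)
        also have "\<dots> = (\<Union>i<n. cylinder (k i) (C i))"
          using kl by (intro SUP_cong cylinder_lift[symmetric]) auto
        finally show ?thesis .
      qed
      have "(\<Union>i. A i) \<oplus>\<^sub>s cylinder l D \<subseteq> ((\<Union>i. A i) - B n) \<union> (\<Union>i<n. A i \<oplus>\<^sub>s cylinder (k i) (C i))"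
        unfolding D B_def by auto
      then have "measure coin_measure ((\<Union>i. A i) \<oplus>\<^sub>s cylinder l D)
          \<le> measure coin_measure (((\<Union>i. A i) - B n) \<union> (\<Union>i<n. A i \<oplus>\<^sub>s cylinder (k i) (C i)))"
        by (rule coin.finite_measure_mono) measurable
      also have "\<dots> \<le> measure coin_measure ((\<Union>i. A i) - B n)
          + measure coin_measure (\<Union>i<n. A i \<oplus>\<^sub>s cylinder (k i) (C i))"
        by (rule measure_Un_le) measurable
      also have "measure coin_measure (\<Union>i<n. A i \<oplus>\<^sub>s cylinder (k i) (C i))
          \<le> (\<Sum>i<n. measure coin_measure (A i \<oplus>\<^sub>s cylinder (k i) (C i)))"
        by (rule measure_UNION_le) auto
      also have "\<dots> \<le> (\<Sum>i<n. e / (2 * (real n + 1)))"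
        using kC by (intro sum_mono) (simp add: less_imp_le)
      also have "\<dots> \<le> e/2"
        using that by (simp add: field_simps)
      also have "measure coin_measure ((\<Union>i. A i) - B n) = measure coin_measure (\<Union>i. A i) - measure coin_measure (B n)"
        by (rule coin.finite_measure_Diff) (auto simp: B_def)
      finally show ?thesis using n by (intro exI[of _ l] exI[of _ D]) linarith
    qed
    then show ?case by auto
  qed
  then show ?thesis using assms(2) by blast
qed

section \<open>Characters and mixing\<close>

text \<open>The transpose of the linear map on finite sets that sends \<open>{i}\<close> to
  \<open>s i\<close>; finiteness of the rows \<open>s i\<close> makes it a continuous
  endomorphism.\<close>

definition dual_map :: "('a \<Rightarrow> 'a set) \<Rightarrow> 'a set \<Rightarrow> 'a set" where
  "dual_map s x = {i. pairing x (s i)}"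

lemma mem_dual_map [simp]: "i \<in> dual_map s x \<longleftrightarrow> pairing x (s i)"
  by (simp add: dual_map_def)

lemma pairing_eqD:
  assumes "\<And>x. pairing x v = pairing x w"
  shows "v = w"
  using assms[of "{i}" for i] by auto

text \<open>The pullback of a character is a character: \<open>w\<close> is the sum of the rows
  indexed by \<open>v\<close>.\<close>

lemma pairing_dual_map:
  assumes "finite v" "\<And>i. finite (s i)"
  shows "\<exists>w. finite w \<and> (\<forall>x. pairing (dual_map s x) v = pairing x w)"
  using assms(1)
proof (induction v rule: finite_induct)
  case empty
  then show ?case by (intro exI[of _ "{}"]) simp
next
  case (insert i v)
  then obtain w where "finite w" "\<forall>x. pairing (dual_map s x) v = pairing x w" by blast
  then show ?case using insert assms(2)
    by (intro exI[of _ "s i \<oplus>\<^sub>s w"]) (auto simp: pairing_insert pairing_sdiff_right)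
qed

lemma dual_map_sdiff:
  assumes "\<And>i. finite (s i)"
  shows "dual_map s (x \<oplus>\<^sub>s y) = dual_map s x \<oplus>\<^sub>s dual_map s y"
  by (auto simp: pairing_sdiff_left assms)

lemma dual_map_locality:
  fixes s :: "nat \<Rightarrow> nat set"
  assumes "\<And>i. finite (s i)"
  shows "\<exists>l. \<forall>x y. y \<inter> {..<l} = x \<inter> {..<l} \<longrightarrow> dual_map s y \<inter> {..<k} = dual_map s x \<inter> {..<k}"
proof -
  have "finite (\<Union>i<k. s i)" using assms by auto
  then obtain l where l: "(\<Union>i<k. s i) \<subseteq> {..<l}" using finite_nat_iff_bounded by auto
  have "dual_map s y \<inter> {..<k} = dual_map s x \<inter> {..<k}" if xy: "y \<inter> {..<l} = x \<inter> {..<l}" for x y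
  proof -
    have "pairing y (s i) = pairing x (s i)" if "i < k" for i
    proof (rule pairing_cong)
      have "s i \<subseteq> {..<l}" using l that by auto
      then show "y \<inter> s i = x \<inter> s i" using xy by (metis inf.absorb2 inf.assoc)
    qed
    then show ?thesis by auto
  qed
  then show ?thesis by blast
qed

section \<open>Walsh functions: characters with values 1 and -1\<close>

definition walsh :: "nat set \<Rightarrow> nat set \<Rightarrow> real" where
  "walsh v x = (if pairing x v then -1 else 1)"

lemma walsh_empty [simp]: "walsh {} x = 1"
  by (simp add: walsh_def)

lemma walsh_measurable [measurable]:
  assumes "finite v"
  shows "walsh v \<in> borel_measurable cantor_borel"
proof -
  obtain k where k: "v \<subseteq> {..<k}" using assms finite_nat_iff_bounded by auto
  have "(x \<inter> {..<k}) \<inter> v = x \<inter> v" for x using k by auto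
  then have "pairing (x \<inter> {..<k}) v = pairing x v" for x by (simp add: pairing_def)
  then have "{x. pairing x v} = cylinder k {c. pairing c v}" by (simp add: cylinder_def)
  then have "{x. pairing x v} \<in> sets cantor_borel" by (metis cylinder_sets)
  then have "Measurable.pred cantor_borel (\<lambda>x. pairing x v)" by (simp add: pred_def)
  then show ?thesis unfolding walsh_def[abs_def] by measurable
qed

lemma integrable_walsh: "finite v \<Longrightarrow> integrable coin_measure (walsh v)"
  by (rule coin.integrable_const_bound[where B = 1])
    (auto simp: walsh_def walsh_measurable cong: measurable_cong_sets)

text \<open>Translating by a single coordinate in \<open>v\<close> changes the sign of the integrand
  and preserves the measure, so the integral equals its own negative.\<close>

lemma integral_walsh:
  assumes "finite v"
  shows "(\<integral>x. walsh v x \<partial>coin_measure) = (if v = {} then 1 else 0)"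
proof (cases "v = {}")
  case True
  then show ?thesis using coin.prob_space by (simp add: walsh_def)
next
  case False
  then obtain i where i: "i \<in> v" by blast
  have "(\<integral>x. walsh v x \<partial>coin_measure) = (\<integral>x. walsh v x \<partial>(distr coin_measure cantor_borel ((\<oplus>\<^sub>s) {i})))"
    by (simp add: distr_coin_translate)
  also have "\<dots> = (\<integral>x. walsh v ({i} \<oplus>\<^sub>s x) \<partial>coin_measure)"
    using translate_measurable walsh_measurable[OF assms] by (intro integral_distr) (auto cong: measurable_cong_sets)
  also have "\<dots> = (\<integral>x. - walsh v x \<partial>coin_measure)"
    using i assms by (intro Bochner_Integration.integral_cong) (auto simp: walsh_def pairing_sdiff_left)
  finally show ?thesis using False by simp
qed

lemma walsh_sdiff:
  assumes "finite v" "finite w"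
  shows "walsh (v \<oplus>\<^sub>s w) x = walsh v x * walsh w x"
  using assms by (auto simp: walsh_def pairing_sdiff_right)

text \<open>Adjoining \<open>i\<close> to \<open>J\<close> multiplies the sum by
  \<open>1 + walsh {i} y\<close>, which is 2 if \<open>i\<close> avoids \<open>y\<close> and 0
  otherwise.\<close>

lemma sum_walsh_Pow:
  assumes "finite J"
  shows "(\<Sum>v\<in>Pow J. walsh v y) = (if y \<inter> J = {} then 2 ^ card J else 0)"
  using assms
proof (induction J rule: finite_induct)
  case empty
  then show ?case by (simp add: walsh_def)
next
  case (insert i J)
  have inj: "inj_on (insert i) (Pow J)" using insert(2) by (auto simp: inj_on_def)
  have "(\<Sum>v\<in>Pow (insert i J). walsh v y) = (\<Sum>v\<in>Pow J. walsh v y) + (\<Sum>v\<in>insert i ` Pow J. walsh v y)"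
    unfolding Pow_insert using insert by (intro sum.union_disjoint) auto
  also have "(\<Sum>v\<in>insert i ` Pow J. walsh v y) = (\<Sum>v\<in>Pow J. walsh (insert i v) y)"
    using inj by (simp add: sum.reindex)
  also have "\<dots> = (\<Sum>v\<in>Pow J. walsh {i} y * walsh v y)"
  proof (intro sum.cong refl)
    fix v assume "v \<in> Pow J"
    then have "finite v" "i \<notin> v" using insert by (auto intro: finite_subset)
    then show "walsh (insert i v) y = walsh {i} y * walsh v y"
      by (auto simp: walsh_def pairing_insert)
  qed
  also have "\<dots> = walsh {i} y * (\<Sum>v\<in>Pow J. walsh v y)"
    by (simp add: sum_distrib_left)
  finally show ?case using insert by (auto simp: walsh_def)
qed

text \<open>Fourier expansion of an atom, obtained by evaluating the full character sum at
  \<open>c \<oplus>\<^sub>s x\<close>.\<close>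

lemma indicator_atom_walsh:
  assumes "c \<subseteq> {..<k}"
  shows "indicator (cylinder k {c}) x = (1/2)^k * (\<Sum>v\<in>Pow {..<k}. walsh v c * walsh v x)"
proof -
  have "(\<Sum>v\<in>Pow {..<k}. walsh v c * walsh v x) = (\<Sum>v\<in>Pow {..<k}. walsh v (c \<oplus>\<^sub>s x))"
    by (intro sum.cong refl) (auto simp: walsh_def pairing_sdiff_left finite_subset)
  also have "\<dots> = (if (c \<oplus>\<^sub>s x) \<inter> {..<k} = {} then 2 ^ k else 0)"
    by (simp add: sum_walsh_Pow)
  also have "(c \<oplus>\<^sub>s x) \<inter> {..<k} = {} \<longleftrightarrow> x \<in> cylinder k {c}"
    using assms by auto
  finally show ?thesis by (simp add: indicator_def power_one_over)
qed

text \<open>The characters of the first k coordinates and their pullbacks are orthogonal as soon as no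
  nontrivial pullback is again such a character.\<close>

lemma measure_atom_Int_vimage:
  assumes g: "g \<in> measurable cantor_borel cantor_borel"
    and pull: "\<And>v. finite v \<Longrightarrow> \<exists>w. finite w \<and> (\<forall>x. pairing (g x) v = pairing x w)"
    and indep: "\<And>v w. v \<subseteq> {..<k} \<Longrightarrow> w \<subseteq> {..<k} \<Longrightarrow> (\<And>x. pairing (g x) w = pairing x v) \<Longrightarrow> w = {}"
    and c: "c \<subseteq> {..<k}" and d: "d \<subseteq> {..<k}"
  shows "measure coin_measure (cylinder k {c} \<inter> g -` cylinder k {d}) = (1/4)^k"
proof -
  obtain P where P: "\<And>v. finite v \<Longrightarrow> finite (P v)" "\<And>v x. finite v \<Longrightarrow> pairing (g x) v = pairing x (P v)"
    using pull by metis
  have fin: "finite v" if "v \<in> Pow {..<k}" for v using that finite_subset by auto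
  have meas: "cylinder k {c} \<inter> g -` cylinder k {d} \<in> sets coin_measure"
    using measurable_sets[OF g cylinder_sets] by auto
  \<comment> \<open>The product of the character \<open>v\<close> with the pullback of
    \<open>w\<close> integrates to 0 unless it is trivial; \<open>indep\<close> leaves the trivial
    pair as the only exception.\<close>
  have zero: "v \<oplus>\<^sub>s P w = {} \<longleftrightarrow> v = {} \<and> w = {}" if "v \<in> Pow {..<k}" "w \<in> Pow {..<k}" for v w
  proof
    assume "v \<oplus>\<^sub>s P w = {}"
    then have "v = P w" by simp
    then have "w = {}" using indep[of v w] P(2) fin that by auto
    moreover have "P {} = {}" by (rule pairing_eqD) (use P(2)[of "{}"] in auto)
    ultimately show "v = {} \<and> w = {}" using \<open>v = P w\<close> by simp
  next
    have "P {} = {}" by (rule pairing_eqD) (use P(2)[of "{}"] in auto)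
    then show "v \<oplus>\<^sub>s P w = {}" if "v = {} \<and> w = {}" using that by simp
  qed
  have "measure coin_measure (cylinder k {c} \<inter> g -` cylinder k {d})
      = (\<integral>x. indicator (cylinder k {c} \<inter> g -` cylinder k {d}) x \<partial>coin_measure)"
    using meas by simp
  also have "\<dots> = (\<integral>x. (\<Sum>v\<in>Pow {..<k}. \<Sum>w\<in>Pow {..<k}.
      ((1/4)^k * walsh v c * walsh w d) * walsh (v \<oplus>\<^sub>s P w) x) \<partial>coin_measure)"
  proof (intro Bochner_Integration.integral_cong refl)
    fix x
    have "indicator (cylinder k {c} \<inter> g -` cylinder k {d}) x
        = (indicator (cylinder k {c}) x * indicator (cylinder k {d}) (g x) :: real)"
      by (simp add: indicator_def)
    also have "\<dots> = (1/2)^k * (1/2)^k * ((\<Sum>v\<in>Pow {..<k}. walsh v c * walsh v x)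
         * (\<Sum>w\<in>Pow {..<k}. walsh w d * walsh w (g x)))"
      by (simp add: indicator_atom_walsh c d del: power_one_over)
    also have "(1/2)^k * (1/2)^k = ((1/4)^k :: real)"
      by (simp flip: power_mult_distrib)
    also have "(1/4)^k * ((\<Sum>v\<in>Pow {..<k}. walsh v c * walsh v x) * (\<Sum>w\<in>Pow {..<k}. walsh w d * walsh w (g x)))
        = (\<Sum>v\<in>Pow {..<k}. \<Sum>w\<in>Pow {..<k}. (1/4)^k * ((walsh v c * walsh v x) * (walsh w d * walsh w (g x))))"
      by (subst sum_product) (simp only: sum_distrib_left)
    also have "\<dots> = (\<Sum>v\<in>Pow {..<k}. \<Sum>w\<in>Pow {..<k}.
      ((1/4)^k * walsh v c * walsh w d) * walsh (v \<oplus>\<^sub>s P w) x)"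
    proof (intro sum.cong refl)
      fix v w assume "v \<in> Pow {..<k}" "w \<in> Pow {..<k}"
      then have "walsh (v \<oplus>\<^sub>s P w) x = walsh v x * walsh w (g x)"
        using fin P by (simp add: walsh_sdiff) (simp add: walsh_def)
      then show "(1/4)^k * ((walsh v c * walsh v x) * (walsh w d * walsh w (g x)))
          = ((1/4)^k * walsh v c * walsh w d) * walsh (v \<oplus>\<^sub>s P w) x"
        by (simp only: mult_ac)
    qed
    finally show "indicator (cylinder k {c} \<inter> g -` cylinder k {d}) x = (\<Sum>v\<in>Pow {..<k}. \<Sum>w\<in>Pow {..<k}.
      ((1/4)^k * walsh v c * walsh w d) * walsh (v \<oplus>\<^sub>s P w) x)" .
  qed
  also have "\<dots> = (\<Sum>v\<in>Pow {..<k}. \<Sum>w\<in>Pow {..<k}. ((1/4)^k * walsh v c * walsh w d)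
      * (\<integral>x. walsh (v \<oplus>\<^sub>s P w) x \<partial>coin_measure))"
  proof -
    have int: "integrable coin_measure (\<lambda>x. a * walsh (v \<oplus>\<^sub>s P w) x)"
      if "v \<in> Pow {..<k}" "w \<in> Pow {..<k}" for v w and a :: real
      using fin[OF that(1)] fin[OF that(2)] P(1)
      by (intro integrable_mult_right integrable_walsh finite_sdiff) auto
    show ?thesis
      by (subst Bochner_Integration.integral_sum, intro Bochner_Integration.integrable_sum int; assumption?)
        (intro sum.cong refl, subst Bochner_Integration.integral_sum, intro int; simp)
  qed
  also have "\<dots> = (\<Sum>v\<in>Pow {..<k}. \<Sum>w\<in>Pow {..<k}. (if w = {} then if v = {} then (1/4)^k else 0 else 0))"
    using fin P by (intro sum.cong refl) (simp add: integral_walsh finite_sdiff zero del: sdiff_eq_empty)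
  also have "\<dots> = (1/4)^k"
    by (simp add: sum.delta)
  finally show ?thesis .
qed

text \<open>A surjection pulls no nontrivial character back to the trivial one, so only the constant
  term in the Fourier expansion of an atom survives integration.\<close>

lemma distr_coin_dual:
  assumes g: "g \<in> measurable cantor_borel cantor_borel"
    and pull: "\<And>v. finite v \<Longrightarrow> \<exists>w. finite w \<and> (\<forall>x. pairing (g x) v = pairing x w)"
    and surj: "surj g"
  shows "distr coin_measure cantor_borel g = coin_measure"
proof (rule distr_coin_eqI[OF g])
  fix k d assume d: "d \<subseteq> {..<k::nat}"
  obtain P where P: "\<And>v. finite v \<Longrightarrow> finite (P v)" "\<And>v x. finite v \<Longrightarrow> pairing (g x) v = pairing x (P v)"
    using pull by metis
  have fin: "finite v" if "v \<in> Pow {..<k}" for v using that finite_subset by auto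
  have zero: "P w = {} \<longleftrightarrow> w = {}" if "finite w" for w
  proof
    assume "P w = {}"
    then have "\<not> pairing (g x) w" for x using P(2)[OF that] by simp
    then have "\<not> pairing y w" for y using surj by (metis surjD)
    then show "w = {}" by (intro pairing_eqD) auto
  next
    show "P w = {}" if "w = {}" by (rule pairing_eqD) (use P(2)[of "{}"] that in auto)
  qed
  have "measure coin_measure (g -` cylinder k {d}) = (\<integral>x. indicator (g -` cylinder k {d}) x \<partial>coin_measure)"
    using measurable_sets[OF g cylinder_sets] by simp
  also have "\<dots> = (\<integral>x. (\<Sum>w\<in>Pow {..<k}. ((1/2)^k * walsh w d) * walsh (P w) x) \<partial>coin_measure)"
  proof (intro Bochner_Integration.integral_cong refl)
    fix x
    have "indicator (g -` cylinder k {d}) x = (indicator (cylinder k {d}) (g x) :: real)"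
      by (simp add: indicator_def)
    also have "\<dots> = (1/2)^k * (\<Sum>w\<in>Pow {..<k}. walsh w d * walsh w (g x))"
      by (simp add: indicator_atom_walsh d)
    finally show "indicator (g -` cylinder k {d}) x = (\<Sum>w\<in>Pow {..<k}. ((1/2)^k * walsh w d) * walsh (P w) x)"
      unfolding sum_distrib_left using fin P by (simp add: walsh_def mult.assoc)
  qed
  also have "\<dots> = (\<Sum>w\<in>Pow {..<k}. ((1/2)^k * walsh w d) * (\<integral>x. walsh (P w) x \<partial>coin_measure))"
    using fin P by (simp add: integrable_walsh)
  also have "\<dots> = (\<Sum>w\<in>Pow {..<k}. if w = {} then (1/2)^k else 0)"
    using fin P by (intro sum.cong refl) (simp add: integral_walsh zero)
  also have "\<dots> = (1/2)^k" by simp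
  finally show "measure coin_measure (g -` cylinder k {d}) = (1/2)^k" .
qed

section \<open>From atoms to arbitrary Borel sets\<close>

lemma measure_cylinder: "measure coin_measure (cylinder k C) = card (C \<inter> Pow {..<k}) * (1/2)^k"
proof -
  have "measure coin_measure (\<Union>c\<in>C \<inter> Pow {..<k}. cylinder k {c})
      = (\<Sum>c\<in>C \<inter> Pow {..<k}. measure coin_measure (cylinder k {c}))"
    by (rule coin.finite_measure_finite_Union) (auto simp: disjoint_family_on_def cylinder_sets)
  then show ?thesis
    unfolding cylinder_atoms[symmetric] by (simp add: measure_coin_atom)
qed

lemma measure_cylinder_Int_vimage:
  assumes g: "g \<in> measurable cantor_borel cantor_borel"
    and atoms: "\<And>c d. c \<subseteq> {..<k} \<Longrightarrow> d \<subseteq> {..<k} \<Longrightarrow>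
      measure coin_measure (cylinder k {c} \<inter> g -` cylinder k {d}) = (1/4)^k"
  shows "measure coin_measure (cylinder k C \<inter> g -` cylinder k D)
    = measure coin_measure (cylinder k C) * measure coin_measure (cylinder k D)"
proof -
  let ?I = "(C \<inter> Pow {..<k}) \<times> (D \<inter> Pow {..<k})"
  have "cylinder k C \<inter> g -` cylinder k D = (\<Union>(c, d)\<in>?I. cylinder k {c} \<inter> g -` cylinder k {d})"
    by auto
  moreover have "measure coin_measure (\<Union>p\<in>?I. case p of (c, d) \<Rightarrow> cylinder k {c} \<inter> g -` cylinder k {d})
      = (\<Sum>p\<in>?I. measure coin_measure (case p of (c, d) \<Rightarrow> cylinder k {c} \<inter> g -` cylinder k {d}))"
    using measurable_sets[OF g cylinder_sets]
    by (intro coin.finite_measure_finite_Union) (auto simp: disjoint_family_on_def cylinder_sets)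
  moreover have "\<dots> = (\<Sum>p\<in>?I. (1/4)^k)"
    by (intro sum.cong refl) (auto simp: atoms)
  moreover have "(1/4)^k = (1/2)^k * ((1/2)^k :: real)"
    by (simp flip: power_mult_distrib)
  ultimately show ?thesis
    by (simp add: measure_cylinder card_cartesian_product del: power_one_over)
qed

lemma measure_diff_le_sdiff:
  assumes "A \<in> sets coin_measure" "B \<in> sets coin_measure"
  shows "\<bar>measure coin_measure A - measure coin_measure B\<bar> \<le> measure coin_measure (A \<oplus>\<^sub>s B)"
proof -
  have *: "measure coin_measure A \<le> measure coin_measure B + measure coin_measure (A \<oplus>\<^sub>s B)"
    if "A \<in> sets coin_measure" "B \<in> sets coin_measure" for A B
  proof -
    have "measure coin_measure A \<le> measure coin_measure (B \<union> (A \<oplus>\<^sub>s B))"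
      using that by (intro coin.finite_measure_mono sets.Un sets_sdiff) auto
    also have "\<dots> \<le> measure coin_measure B + measure coin_measure (A \<oplus>\<^sub>s B)"
      using that by (intro measure_Un_le sets_sdiff)
    finally show ?thesis .
  qed
  show ?thesis using *[OF assms] *[OF assms(2,1)] by (simp add: sdiff_commute abs_le_iff)
qed

text \<open>Independence on atoms of a fixed length is exact for all but finitely many
  \<open>n\<close>. Cylinders of a common length approximate \<open>A\<close> and \<open>B\<close>
  within \<open>e/4\<close>, and each approximation is paid for twice, once in the intersection and
  once in the product.\<close>

lemma mixing_coinI:
  fixes g :: "int ^ 'd::finite \<Rightarrow> nat set \<Rightarrow> nat set"
  assumes g: "\<And>n. g n \<in> measurable cantor_borel cantor_borel"
    and pres: "\<And>n. distr coin_measure cantor_borel (g n) = coin_measure"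
    and atoms: "\<And>k. \<forall>\<^sub>F n in cofinite. \<forall>c d. c \<subseteq> {..<k} \<longrightarrow> d \<subseteq> {..<k} \<longrightarrow>
      measure coin_measure (cylinder k {c} \<inter> g n -` cylinder k {d}) = (1/4)^k"
  shows "mixing_action coin_measure g"
  unfolding mixing_action_def
proof (intro ballI tendstoI)
  let ?m = "measure coin_measure"
  fix A B and e :: real
  assume A [measurable]: "A \<in> sets coin_measure" and B [measurable]: "B \<in> sets coin_measure" and e: "e > 0"
  obtain k C where kC: "?m (A \<oplus>\<^sub>s cylinder k C) < e/4" using coin_approx_cylinder[OF A, of "e/4"] e by auto
  obtain l D where lD: "?m (B \<oplus>\<^sub>s cylinder l D) < e/4" using coin_approx_cylinder[OF B, of "e/4"] e by auto
  define h where "h = max k l"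
  obtain C' D' where C': "cylinder k C = cylinder h C'" and D': "cylinder l D = cylinder h D'"
    using cylinder_lift[of k h C] cylinder_lift[of l h D] by (auto simp: h_def)
  define A' B' where "A' = cylinder h C'" and "B' = cylinder h D'"
  have A': "?m (A \<oplus>\<^sub>s A') < e/4" "A' \<in> sets coin_measure"
    and B': "?m (B \<oplus>\<^sub>s B') < e/4" "B' \<in> sets coin_measure"
    using kC lD by (auto simp: A'_def B'_def C' D' cylinder_sets)
  have gs: "g n -` Q \<in> sets coin_measure" if "Q \<in> sets coin_measure" for n Q
    using measurable_sets[OF g] that by (metis Int_UNIV_right sets_coin space_cantor_borel)
  have gm: "?m (g n -` Q) = ?m Q" if "Q \<in> sets coin_measure" for n Q
    using measure_distr[of "g n" coin_measure cantor_borel Q] g pres that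
    by (simp cong: measurable_cong_sets)
  show "\<forall>\<^sub>F n in cofinite. dist (?m (A \<inter> (g n -` B \<inter> space coin_measure))) (?m A * ?m B) < e"
    using atoms[of h]
  proof eventually_elim
    case (elim n)
    have "?m (A' \<inter> g n -` B') = ?m A' * ?m B'"
      unfolding A'_def B'_def using elim by (intro measure_cylinder_Int_vimage g) auto
    moreover have "\<bar>?m (A \<inter> g n -` B) - ?m (A' \<inter> g n -` B')\<bar> \<le> ?m (A \<oplus>\<^sub>s A') + ?m (B \<oplus>\<^sub>s B')"
    proof -
      have "\<bar>?m (A \<inter> g n -` B) - ?m (A' \<inter> g n -` B')\<bar> \<le> ?m ((A \<inter> g n -` B) \<oplus>\<^sub>s (A' \<inter> g n -` B'))"
        using A' B' A B gs by (intro measure_diff_le_sdiff) auto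
      also have "\<dots> \<le> ?m ((A \<oplus>\<^sub>s A') \<union> g n -` (B \<oplus>\<^sub>s B'))"
        using A' B' A B by (intro coin.finite_measure_mono sets.Un gs sets_sdiff) auto
      also have "\<dots> \<le> ?m (A \<oplus>\<^sub>s A') + ?m (g n -` (B \<oplus>\<^sub>s B'))"
        using A' B' A B by (intro measure_Un_le gs sets_sdiff) auto
      also have "?m (g n -` (B \<oplus>\<^sub>s B')) = ?m (B \<oplus>\<^sub>s B')"
        using B B' by (intro gm sets_sdiff)
      finally show ?thesis .
    qed
    moreover have "\<bar>?m A * ?m B - ?m A' * ?m B'\<bar> \<le> ?m (A \<oplus>\<^sub>s A') + ?m (B \<oplus>\<^sub>s B')"
    proof -
      have "?m A * ?m B - ?m A' * ?m B' = (?m A - ?m A') * ?m B + ?m A' * (?m B - ?m B')"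
        by (simp add: algebra_simps)
      then have "\<bar>?m A * ?m B - ?m A' * ?m B'\<bar> \<le> \<bar>?m A - ?m A'\<bar> * ?m B + ?m A' * \<bar>?m B - ?m B'\<bar>"
        by (metis abs_mult abs_of_nonneg abs_triangle_ineq measure_nonneg)
      also have "\<dots> \<le> \<bar>?m A - ?m A'\<bar> * 1 + 1 * \<bar>?m B - ?m B'\<bar>"
        by (intro add_mono mult_mono) auto
      also have "\<dots> \<le> ?m (A \<oplus>\<^sub>s A') + ?m (B \<oplus>\<^sub>s B')"
        using measure_diff_le_sdiff[OF A A'(2)] measure_diff_le_sdiff[OF B B'(2)] by simp
      finally show ?thesis .
    qed
    ultimately show ?case using A'(1) B'(1) by (simp add: dist_real_def)
  qed
qed

section \<open>Entropy\<close>

lemma finite_cube: "finite (cube k :: (int ^ 'd::finite) set)"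
  and card_cube: "card (cube k :: (int ^ 'd::finite) set) = k ^ CARD('d)"
proof -
  have inj: "inj_on vec_nth (cube k :: (int ^ 'd) set)"
    by (auto simp: inj_on_def vec_eq_iff)
  have img: "vec_nth ` (cube k :: (int ^ 'd) set) = Pi\<^sub>E UNIV (\<lambda>_. {0..<int k})"
  proof (intro equalityI subsetI)
    fix h :: "'d \<Rightarrow> int" assume "h \<in> Pi\<^sub>E UNIV (\<lambda>_. {0..<int k})"
    then have "vec_lambda h \<in> (cube k :: (int ^ 'd) set)" by (auto simp: cube_def PiE_iff)
    then show "h \<in> vec_nth ` (cube k :: (int ^ 'd) set)"
      by (metis image_eqI UNIV_I vec_lambda_inverse)
  qed (auto simp: cube_def PiE_iff)
  have "finite (vec_nth ` (cube k :: (int ^ 'd) set))"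
    unfolding img by (intro finite_PiE) auto
  then show "finite (cube k :: (int ^ 'd) set)" using inj finite_imageD by blast
  have "card (cube k :: (int ^ 'd) set) = card (vec_nth ` (cube k :: (int ^ 'd) set))"
    using inj by (simp add: card_image)
  also have "\<dots> = k ^ CARD('d)" unfolding img by (simp add: card_PiE)
  finally show "card (cube k :: (int ^ 'd) set) = k ^ CARD('d)" .
qed

text \<open>Termwise from \<open>ln t \<le> t - 1\<close> at \<open>t = q i / p i\<close>; for
  \<open>p i = 0\<close> the convention \<open>0 * ln 0 = 0\<close> fits.\<close>

lemma gibbs_inequality:
  fixes p q :: "'i \<Rightarrow> real"
  assumes "\<And>i. i \<in> I \<Longrightarrow> p i \<ge> 0" "\<And>i. i \<in> I \<Longrightarrow> q i > 0"
    and "sum q I \<le> sum p I"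
  shows "- (\<Sum>i\<in>I. p i * ln (p i)) \<le> (\<Sum>i\<in>I. p i * - ln (q i))"
proof -
  have "p i * ln (q i) - p i * ln (p i) \<le> q i - p i" if "i \<in> I" for i
  proof (cases "p i = 0")
    case False
    then have p: "p i > 0" and q: "q i > 0" using assms(1,2)[OF that] by auto
    have "p i * ln (q i) - p i * ln (p i) = p i * ln (q i / p i)"
      using p q by (simp add: ln_div algebra_simps)
    also have "\<dots> \<le> p i * (q i / p i - 1)"
      using p q by (intro mult_left_mono ln_le_minus_one) auto
    also have "\<dots> = q i - p i" using p by (simp add: field_simps)
    finally show ?thesis .
  qed (use assms(2)[OF that] in simp)
  then have "(\<Sum>i\<in>I. p i * ln (q i) - p i * ln (p i)) \<le> (\<Sum>i\<in>I. q i - p i)"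
    by (rule sum_mono)
  then show ?thesis using assms(3) by (simp add: sum_subtractf sum_negf)
qed

text \<open>Source coding: \<open>q\<close> is a subprobability on the values of \<open>W\<close>,
  \<open>- ln (q w)\<close> is the length of a code word, and \<open>h\<close> dominates the length
  of the code word of the name at a point.\<close>

lemma (in prob_space) entropy_le_expectation:
  fixes W :: "'a \<Rightarrow> 'w" and q :: "'w \<Rightarrow> real"
  assumes fin: "finite (W ` space M)"
    and meas: "\<And>w. W -` {w} \<inter> space M \<in> events"
    and pos: "\<And>w. w \<in> W ` space M \<Longrightarrow> q w > 0" and le1: "sum q (W ` space M) \<le> 1"
    and h: "integrable M h" "\<And>x. x \<in> space M \<Longrightarrow> - ln (q (W x)) \<le> h x"
  shows "- (\<Sum>w\<in>W ` space M. prob (W -` {w} \<inter> space M) * ln (prob (W -` {w} \<inter> space M))) \<le> expectation h"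
proof -
  let ?R = "W ` space M" and ?p = "\<lambda>w. prob (W -` {w} \<inter> space M)"
  have "prob (\<Union>w\<in>?R. W -` {w} \<inter> space M) = sum ?p ?R"
    using fin meas by (intro finite_measure_finite_Union) (auto simp: disjoint_family_on_def)
  moreover have "(\<Union>w\<in>?R. W -` {w} \<inter> space M) = space M" by auto
  ultimately have "sum ?p ?R = 1" using prob_space by simp
  then have "- (\<Sum>w\<in>?R. ?p w * ln (?p w)) \<le> (\<Sum>w\<in>?R. ?p w * - ln (q w))"
    using pos le1 by (intro gibbs_inequality) auto
  also have "\<dots> = (\<Sum>w\<in>?R. expectation (\<lambda>x. indicator (W -` {w} \<inter> space M) x * - ln (q w)))"
    using meas by (intro sum.cong refl) (simp add: Int_absorb1)
  also have "\<dots> = expectation (\<lambda>x. \<Sum>w\<in>?R. indicator (W -` {w} \<inter> space M) x * - ln (q w))"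
    using meas by (intro Bochner_Integration.integral_sum[symmetric] integrable_mult_left)
      (auto simp: integrable_indicator_iff emeasure_eq_measure)
  also have "\<dots> \<le> expectation h"
  proof (rule integral_mono)
    show "integrable M (\<lambda>x. \<Sum>w\<in>?R. indicator (W -` {w} \<inter> space M) x * - ln (q w))"
      using meas by (intro Bochner_Integration.integrable_sum integrable_mult_left)
        (auto simp: integrable_indicator_iff emeasure_eq_measure)
    fix x assume x: "x \<in> space M"
    have "(\<Sum>w\<in>?R. indicator (W -` {w} \<inter> space M) x * - ln (q w))
        = (\<Sum>w\<in>?R. if w = W x then - ln (q w) else 0)"
      using x by (intro sum.cong refl) (auto simp: indicator_def)
    also have "\<dots> = - ln (q (W x))" using fin x by (simp add: sum.delta)
    finally show "(\<Sum>w\<in>?R. indicator (W -` {w} \<inter> space M) x * - ln (q w)) \<le> h x"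
      using h(2)[OF x] by simp
  qed (rule h(1))
  finally show ?thesis .
qed

section \<open>Names of a partition along a finite set of lattice points\<close>

definition part_cell :: "'a set set \<Rightarrow> 'a \<Rightarrow> 'a set" where
  "part_cell P x = (THE A. A \<in> P \<and> x \<in> A)"

lemma part_cell_eqI:
  assumes "finite_meas_partition M P" "A \<in> P" "x \<in> A"
  shows "part_cell P x = A"
  unfolding part_cell_def
  using assms by (intro the_equality) (auto simp: finite_meas_partition_def disjoint_def)

lemma part_cell:
  assumes "finite_meas_partition M P" "x \<in> space M"
  shows "part_cell P x \<in> P" "x \<in> part_cell P x"
proof -
  obtain A where "A \<in> P" "x \<in> A" using assms by (auto simp: finite_meas_partition_def)
  then show "part_cell P x \<in> P" "x \<in> part_cell P x" using part_cell_eqI[OF assms(1)] by auto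
qed

text \<open>Distinct choices of cells may give the same set only when it is empty on the points
  concerned, so the nonempty members of the join are the fibres of the name map \<open>W\<close>;
  the empty set contributes \<open>0 * ln 0 = 0\<close>.\<close>

lemma part_entropy_join:
  assumes P: "finite_meas_partition M P" and F: "finite F"
    and g: "\<And>n x. x \<in> space M \<Longrightarrow> g n x \<in> space M"
  defines "W \<equiv> \<lambda>x. restrict (\<lambda>n. part_cell P (g n x)) F"
  shows "part_entropy M (join_partition M g P F) = - (\<Sum>w\<in>W ` space M.
      measure M (W -` {w} \<inter> space M) * ln (measure M (W -` {w} \<inter> space M)))"
proof -
  have fib: "W -` {W x} \<inter> space M = space M \<inter> (\<Inter>n\<in>F. g n -` W x n)" if x: "x \<in> space M" for x
  proof (intro equalityI subsetI)
    fix y assume y: "y \<in> W -` {W x} \<inter> space M"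
    then have "W y n = W x n" for n by simp
    then have "g n y \<in> W x n" if "n \<in> F" for n
      using that part_cell(2)[OF P g[of y n]] y by (metis IntE W_def restrict_apply')
    then show "y \<in> space M \<inter> (\<Inter>n\<in>F. g n -` W x n)" using y by auto
  next
    fix y assume y: "y \<in> space M \<inter> (\<Inter>n\<in>F. g n -` W x n)"
    have "W y = W x"
    proof
      fix n
      show "W y n = W x n"
      proof (cases "n \<in> F")
        case True
        then have "g n y \<in> part_cell P (g n x)" using y by (auto simp: W_def)
        then show ?thesis using part_cell_eqI[OF P part_cell(1)[OF P g[OF x]]] True by (simp add: W_def)
      qed (simp add: W_def)
    qed
    then show "y \<in> W -` {W x} \<inter> space M" using y by simp
  qed
  have img: "join_partition M g P F - {{}} = (\<lambda>w. W -` {w} \<inter> space M) ` W ` space M"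
  proof (intro equalityI subsetI)
    fix A assume "A \<in> join_partition M g P F - {{}}"
    then obtain c x where c: "\<forall>n\<in>F. c n \<in> P" and A: "A = space M \<inter> (\<Inter>n\<in>F. g n -` c n)" and x: "x \<in> A"
      by (auto simp: join_partition_def)
    have xs: "x \<in> space M" using x A by auto
    have "W x n = c n" if "n \<in> F" for n
      using that c x part_cell_eqI[OF P, of "c n" "g n x"] unfolding A by (auto simp: W_def)
    then have "A = W -` {W x} \<inter> space M" using fib[OF xs] unfolding A by simp
    then show "A \<in> (\<lambda>w. W -` {w} \<inter> space M) ` W ` space M" using xs by blast
  next
    fix A assume "A \<in> (\<lambda>w. W -` {w} \<inter> space M) ` W ` space M"
    then obtain x where x: "x \<in> space M" and A: "A = W -` {W x} \<inter> space M" by auto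
    have "W x n \<in> P" if "n \<in> F" for n using that part_cell(1)[OF P g[OF x]] by (simp add: W_def)
    then have "A \<in> join_partition M g P F" unfolding A fib[OF x] join_partition_def by blast
    moreover have "x \<in> A" using x A by simp
    ultimately show "A \<in> join_partition M g P F - {{}}" by blast
  qed
  have "W ` space M \<subseteq> Pi\<^sub>E F (\<lambda>_. P)"
    using part_cell(1)[OF P g] by (auto simp: W_def)
  then have finW: "finite (W ` space M)"
    using F P by (meson finite_PiE finite_meas_partition_def finite_subset)
  then have "finite (join_partition M g P F)" using img by (metis finite_Diff2 finite.emptyI finite.insertI finite_imageI)
  then have "part_entropy M (join_partition M g P F)
      = - (\<Sum>A\<in>join_partition M g P F - {{}}. measure M A * ln (measure M A))"
    unfolding part_entropy_def by (intro arg_cong[where f = uminus] sum.mono_neutral_right) auto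
  also have "\<dots> = - (\<Sum>w\<in>W ` space M.
      measure M (W -` {w} \<inter> space M) * ln (measure M (W -` {w} \<inter> space M)))"
    unfolding img by (subst sum.reindex) (auto simp: inj_on_def)
  finally show ?thesis .
qed

text \<open>Every cell is approximated by a cylinder up to \<open>e / card P\<close>. Outside the
  union of the errors the prefix lies in exactly one of these cylinders, and it names the right
  cell.\<close>

lemma coin_approx_partition:
  assumes P: "finite_meas_partition coin_measure P" and e: "e > 0"
  shows "\<exists>m Q. range Q \<subseteq> P \<and> {x. Q (x \<inter> {..<m}) \<noteq> part_cell P x} \<in> sets coin_measure \<and>
    measure coin_measure {x. Q (x \<inter> {..<m}) \<noteq> part_cell P x} < e"
proof -
  have finP: "finite P" and Ps: "P \<subseteq> sets coin_measure" and PU: "\<Union>P = UNIV"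
    using P by (auto simp: finite_meas_partition_def)
  then have ne: "P \<noteq> {}" by auto
  have "\<exists>k C. measure coin_measure (A \<oplus>\<^sub>s cylinder k C) < e / card P" if "A \<in> P" for A
    using that Ps e finP ne by (intro coin_approx_cylinder) (auto simp: card_gt_0_iff)
  then obtain k C where kC: "\<And>A. A \<in> P \<Longrightarrow> measure coin_measure (A \<oplus>\<^sub>s cylinder (k A) (C A)) < e / card P"
    by metis
  define m where "m = (\<Sum>A\<in>P. k A)"
  have km: "k A \<le> m" if "A \<in> P" for A using that finP unfolding m_def by (intro member_le_sum) auto
  define D where "D A = {c. c \<inter> {..<k A} \<in> C A}" for A
  have D: "cylinder (k A) (C A) = cylinder m (D A)" if "A \<in> P" for A
    unfolding D_def by (rule cylinder_lift[OF km[OF that]])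
  obtain A0 where A0: "A0 \<in> P" using ne by blast
  \<comment> \<open>\<open>A0\<close> is an arbitrary answer for prefixes claimed by no cell or by
    several; these occur only inside the error set.\<close>
  define Q where "Q c = (if \<exists>!A. A \<in> P \<and> c \<in> D A then THE A. A \<in> P \<and> c \<in> D A else A0)" for c
  have Q: "Q c \<in> P" for c
  proof (cases "\<exists>!A. A \<in> P \<and> c \<in> D A")
    case True
    then show ?thesis using theI'[OF True] by (simp add: Q_def)
  qed (use A0 in \<open>auto simp: Q_def\<close>)
  let ?E = "\<Union>A\<in>P. A \<oplus>\<^sub>s cylinder (k A) (C A)"
  have sub: "{x. Q (x \<inter> {..<m}) \<noteq> part_cell P x} \<subseteq> ?E"
  proof
    fix x assume x: "x \<in> {x. Q (x \<inter> {..<m}) \<noteq> part_cell P x}"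
    show "x \<in> ?E"
    proof (rule ccontr)
      assume "x \<notin> ?E"
      then have eq: "x \<in> A \<longleftrightarrow> x \<inter> {..<m} \<in> D A" if "A \<in> P" for A using that D[OF that] by auto
      have "x \<in> A \<longleftrightarrow> A = part_cell P x" if "A \<in> P" for A
        using that part_cell[OF P, of x] part_cell_eqI[OF P that] by auto
      then have *: "A \<in> P \<and> x \<inter> {..<m} \<in> D A \<longleftrightarrow> A = part_cell P x" for A
        using eq part_cell(1)[OF P, of x] by auto
      have "Q (x \<inter> {..<m}) = part_cell P x" unfolding Q_def * by simp
      then show False using x by simp
    qed
  qed
  have "{x. Q (x \<inter> {..<m}) \<noteq> part_cell P x} = (\<Union>A\<in>P. A \<inter> cylinder m {c. Q c \<noteq> A})"
  proof (intro equalityI subsetI)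
    fix x assume "x \<in> {x. Q (x \<inter> {..<m}) \<noteq> part_cell P x}"
    then show "x \<in> (\<Union>A\<in>P. A \<inter> cylinder m {c. Q c \<noteq> A})"
      using part_cell[OF P, of x] by (intro UN_I[of "part_cell P x"]) auto
  next
    fix x assume "x \<in> (\<Union>A\<in>P. A \<inter> cylinder m {c. Q c \<noteq> A})"
    then show "x \<in> {x. Q (x \<inter> {..<m}) \<noteq> part_cell P x}"
      using part_cell_eqI[OF P] by auto
  qed
  then have ms: "{x. Q (x \<inter> {..<m}) \<noteq> part_cell P x} \<in> sets coin_measure"
    using finP Ps by (auto simp: cylinder_sets intro!: sets.finite_UN)
  have "measure coin_measure {x. Q (x \<inter> {..<m}) \<noteq> part_cell P x} \<le> measure coin_measure ?E"
    using finP Ps sub by (intro coin.finite_measure_mono sets.finite_UN sets_sdiff) (auto simp: cylinder_sets)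
  also have "\<dots> \<le> (\<Sum>A\<in>P. measure coin_measure (A \<oplus>\<^sub>s cylinder (k A) (C A)))"
    using finP Ps by (intro measure_UNION_le sets_sdiff) (auto simp: cylinder_sets)
  also have "\<dots> < (\<Sum>A\<in>P. e / card P)"
    using finP ne kC by (intro sum_strict_mono) auto
  also have "\<dots> = e" using finP ne by simp
  finally show ?thesis using Q ms by blast
qed

text \<open>The words of \<open>P\<close> along \<open>F\<close> are coded by choosing a word of the approximating cylinder partition
  uniformly and passing it through a memoryless channel with error probability \<open>\<delta>\<close>; Gibbs'
  inequality turns this code into an entropy bound.\<close>

lemma entropy_join_le:
  fixes g :: "'n \<Rightarrow> nat set \<Rightarrow> nat set"
  assumes P: "finite_meas_partition coin_measure P" and F: "finite F"
    and g: "\<And>n. g n \<in> measurable cantor_borel cantor_borel"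
    and pres: "\<And>n. distr coin_measure cantor_borel (g n) = coin_measure"
    and Q: "\<And>x. Q (x \<inter> {..<m}) \<in> P"
      "{x. Q (x \<inter> {..<m}) \<noteq> part_cell P x} \<in> sets coin_measure"
    and d: "0 < d" "d < (1::real)"
    and names: "card (range (\<lambda>x. restrict (\<lambda>n. g n x \<inter> {..<m}) F)) \<le> N"
  shows "part_entropy coin_measure (join_partition coin_measure g P F) \<le> ln N + card F *
     (- ln (1 - d) + ln (card P / d) * measure coin_measure {x. Q (x \<inter> {..<m}) \<noteq> part_cell P x})"
proof -
  define E where "E = {x. Q (x \<inter> {..<m}) \<noteq> part_cell P x}"
  define W where "W x = restrict (\<lambda>n. part_cell P (g n x)) F" for x
  define V where "V x = restrict (\<lambda>n. Q (g n x \<inter> {..<m})) F" for x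
  define R where "R = range V"
  have finP: "finite P" and Ps: "P \<subseteq> sets coin_measure" and PU: "\<Union>P = UNIV"
    using P by (auto simp: finite_meas_partition_def)
  then have r: "card P > 0" by (auto simp: card_gt_0_iff)
  \<comment> \<open>The channel: the predicted cell has weight \<open>1 - d\<close>, every other one
    \<open>d / card P\<close>. Dividing by \<open>card P\<close> instead of
    \<open>card P - 1\<close> leaves row sums at most 1 and covers one-cell partitions.\<close>
  define T where "T a b = (if a = b then 1 - d else d / card P)" for a b :: "nat set set"
  have Tpos: "T a b > 0" for a b using d r by (auto simp: T_def)
  have Tsum: "(\<Sum>b\<in>P. T a b) \<le> 1" if "a \<in> P" for a
  proof -
    have "(\<Sum>b\<in>P. T a b) = T a a + (\<Sum>b\<in>P - {a}. T a b)"
      using finP that by (rule sum.remove)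
    also have "(\<Sum>b\<in>P - {a}. T a b) = (\<Sum>b\<in>P - {a}. d / card P)"
      by (intro sum.cong) (auto simp: T_def)
    also have "\<dots> \<le> (\<Sum>b\<in>P. d / card P)"
      using d finP by (intro sum_mono2) auto
    also have "\<dots> = d" using r by simp
    finally show ?thesis by (simp add: T_def)
  qed
  let ?names = "range (\<lambda>x. restrict (\<lambda>n. g n x \<inter> {..<m}) F)"
  have fnames: "finite ?names"
    by (rule finite_subset[of _ "Pi\<^sub>E F (\<lambda>_. Pow {..<m})"]) (auto intro: finite_PiE F)
  have Rimg: "R = (\<lambda>w. restrict (\<lambda>n. Q (w n)) F) ` ?names"
    unfolding R_def image_image V_def by (intro image_cong refl ext) (simp add: restrict_def)
  have finR: "finite R" unfolding Rimg using fnames by (rule finite_imageI)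
  have cR: "card R \<le> N" using names card_image_le[OF fnames] unfolding Rimg by (rule order_trans[rotated])
  have Rne: "card R > 0" using finR by (auto simp: R_def card_gt_0_iff)
  \<comment> \<open>The output distribution of the channel for a uniformly chosen predicted word in
    \<open>R\<close>.\<close>
  define q where "q w = (\<Sum>v\<in>R. (1 / card R) * (\<Prod>n\<in>F. T (v n) (w n)))" for w
  have qpos: "q w > 0" for w
    unfolding q_def using finR Rne Tpos by (intro sum_pos mult_pos_pos prod_pos) (auto simp: R_def)
  have Wsub: "range W \<subseteq> Pi\<^sub>E F (\<lambda>_. P)"
    using part_cell(1)[OF P] by (auto simp: W_def)
  have finPE: "finite (Pi\<^sub>E F (\<lambda>_. P))" using F finP by (intro finite_PiE) auto
  have "sum q (range W) \<le> sum q (Pi\<^sub>E F (\<lambda>_. P))"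
    using Wsub finPE qpos by (intro sum_mono2) (auto simp: less_imp_le)
  also have "\<dots> = (\<Sum>v\<in>R. (1 / card R) * (\<Sum>w\<in>Pi\<^sub>E F (\<lambda>_. P). \<Prod>n\<in>F. T (v n) (w n)))"
    unfolding q_def by (subst sum.swap) (simp add: sum_distrib_left)
  also have "\<dots> \<le> (\<Sum>v\<in>R. (1 / card R) * 1)"
  proof (intro sum_mono mult_left_mono)
    fix v assume "v \<in> R"
    then have v: "v n \<in> P" if "n \<in> F" for n using that Q(1) by (auto simp: R_def V_def)
    have "(\<Sum>w\<in>Pi\<^sub>E F (\<lambda>_. P). \<Prod>n\<in>F. T (v n) (w n)) = (\<Prod>n\<in>F. \<Sum>b\<in>P. T (v n) b)"
      using F finP by (simp add: prod_sum_PiE)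
    also have "\<dots> \<le> (\<Prod>n\<in>F. 1)"
      using v Tsum Tpos by (intro prod_mono) (auto intro!: sum_nonneg simp: less_imp_le)
    finally show "(\<Sum>w\<in>Pi\<^sub>E F (\<lambda>_. P). \<Prod>n\<in>F. T (v n) (w n)) \<le> 1" by simp
  qed simp
  also have "\<dots> = 1" using Rne by simp
  finally have qsum: "sum q (range W) \<le> 1" .
  \<comment> \<open>The cost of one letter: \<open>- ln (1 - d)\<close> for a correct prediction and
    \<open>ln (card P / d)\<close> for a wrong one. By invariance its expectation is the same at
    every lattice point.\<close>
  define t where "t y = - ln (1 - d) + (ln (card P / d) + ln (1 - d)) * indicator E y" for y
  have t: "t y = - ln (T (Q (y \<inter> {..<m})) (part_cell P y))" for y
    using d r by (auto simp: t_def T_def E_def indicator_def ln_div)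
  have Es: "E \<in> sets coin_measure" using Q(2) by (simp add: E_def)
  have tint: "integrable coin_measure t"
    unfolding t_def using Es by (auto simp: integrable_indicator_iff coin.emeasure_eq_measure)
  have gc: "g n \<in> measurable coin_measure cantor_borel" for n using g by (simp cong: measurable_cong_sets)
  have tm: "t \<in> borel_measurable cantor_borel"
    using tint by (auto dest!: borel_measurable_integrable cong: measurable_cong_sets)
  have tgint: "integrable coin_measure (\<lambda>x. t (g n x))" for n
    using tint pres integrable_distr_eq[OF gc tm] by metis
  have tgval: "(\<integral>x. t (g n x) \<partial>coin_measure) = (\<integral>x. t x \<partial>coin_measure)" for n
    using integral_distr[OF gc tm] pres by metis
  \<comment> \<open>Keeping only the summand of \<open>q\<close> at \<open>V x\<close> bounds the
    code length by the cost \<open>ln N\<close> of choosing the predicted word plus the costs of its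
    letters.\<close>
  define h where "h x = ln N + (\<Sum>n\<in>F. t (g n x))" for x
  have hint: "integrable coin_measure h"
    unfolding h_def using tgint by auto
  have hq: "- ln (q (W x)) \<le> h x" for x
  proof -
    have "V x \<in> R" by (simp add: R_def)
    have "(1 / N) * (\<Prod>n\<in>F. T (V x n) (W x n)) \<le> (1 / card R) * (\<Prod>n\<in>F. T (V x n) (W x n))"
      using cR Rne Tpos by (intro mult_right_mono prod_nonneg) (auto simp: frac_le less_imp_le)
    also have "\<dots> \<le> q (W x)"
      unfolding q_def using finR \<open>V x \<in> R\<close> Tpos
      by (intro member_le_sum[where f = "\<lambda>v. (1 / card R) * (\<Prod>n\<in>F. T (v n) (W x n))"])
        (auto intro!: divide_nonneg_nonneg prod_nonneg simp: less_imp_le)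
    finally have le: "(1 / N) * (\<Prod>n\<in>F. T (V x n) (W x n)) \<le> q (W x)" .
    have N: "real N > 0" using cR Rne by linarith
    have pp: "(\<Prod>n\<in>F. T (V x n) (W x n)) > 0" using Tpos by (intro prod_pos) auto
    have "ln ((1 / N) * (\<Prod>n\<in>F. T (V x n) (W x n))) \<le> ln (q (W x))"
      using le N pp qpos by (subst ln_le_cancel_iff) auto
    moreover have "ln ((1 / N) * (\<Prod>n\<in>F. T (V x n) (W x n))) = - ln N + ln (\<Prod>n\<in>F. T (V x n) (W x n))"
      using N pp by (simp add: ln_div)
    moreover have "ln (\<Prod>n\<in>F. T (V x n) (W x n)) = (\<Sum>n\<in>F. ln (T (V x n) (W x n)))"
    proof (rule ln_prod[OF F])
      show "T (V x n) (W x n) \<noteq> 0" for n using Tpos[of "V x n" "W x n"] by simp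
    qed
    moreover have "(\<Sum>n\<in>F. ln (T (V x n) (W x n))) = (\<Sum>n\<in>F. - t (g n x))"
      unfolding t by (intro sum.cong refl) (simp add: V_def W_def)
    ultimately show ?thesis by (simp add: h_def sum_negf)
  qed
  have Wmeas: "W -` {w} \<inter> space coin_measure \<in> sets coin_measure" for w
  proof (cases "w \<in> range W")
    case True
    then obtain x0 where x0: "w = W x0" by auto
    have "W -` {w} = (\<Inter>n\<in>F. g n -` part_cell P (g n x0))"
    proof (intro equalityI subsetI)
      fix y assume "y \<in> W -` {w}"
      then have "W y n = W x0 n" for n using x0 by simp
      then have "part_cell P (g n y) = part_cell P (g n x0)" if "n \<in> F" for n
        using that by (metis W_def restrict_apply')
      then show "y \<in> (\<Inter>n\<in>F. g n -` part_cell P (g n x0))"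
        using part_cell(2)[OF P] by auto
    next
      fix y assume "y \<in> (\<Inter>n\<in>F. g n -` part_cell P (g n x0))"
      then have "part_cell P (g n y) = part_cell P (g n x0)" if "n \<in> F" for n
        using that part_cell_eqI[OF P part_cell(1)[OF P]] by auto
      then have "W y = W x0" unfolding W_def by (rule restrict_ext)
      then show "y \<in> W -` {w}" by (simp add: x0)
    qed
    moreover have "(\<Inter>n\<in>F. g n -` part_cell P (g n x0)) \<in> sets coin_measure"
    proof (cases "F = {}")
      case False
      have "g n -` part_cell P (g n x0) \<in> sets coin_measure" for n
        using measurable_sets[OF gc, of "part_cell P (g n x0)" n] part_cell(1)[OF P] Ps by auto
      then show ?thesis using False F by (intro sets.finite_INT) auto
    qed (metis INT_empty sets.top space_coin)
    ultimately show ?thesis by simp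
  next
    case False
    then have "W -` {w} = {}" by auto
    then show ?thesis by simp
  qed
  have "part_entropy coin_measure (join_partition coin_measure g P F)
    = - (\<Sum>w\<in>W ` space coin_measure. measure coin_measure (W -` {w} \<inter> space coin_measure)
        * ln (measure coin_measure (W -` {w} \<inter> space coin_measure)))"
    unfolding W_def by (rule part_entropy_join[OF P F]) simp
  also have "\<dots> \<le> coin.expectation h"
    using finPE Wsub qpos qsum hq
    by (intro coin.entropy_le_expectation[where q = q] Wmeas hint) (auto intro: finite_subset)
  also have "\<dots> = ln N + card F * coin.expectation t"
    unfolding h_def using tgint tgval coin.prob_space by (simp add: Bochner_Integration.integral_sum)
  also have "coin.expectation t = - ln (1 - d) + (ln (card P / d) + ln (1 - d)) * measure coin_measure E"
    unfolding t_def using Es coin.prob_space by (simp add: integrable_indicator_iff coin.emeasure_eq_measure)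
  also have "ln N + card F * (- ln (1 - d) + (ln (card P / d) + ln (1 - d)) * measure coin_measure E)
      \<le> ln N + card F * (- ln (1 - d) + ln (card P / d) * measure coin_measure E)"
    using d by (intro add_left_mono mult_left_mono mult_right_mono) auto
  finally show ?thesis unfolding E_def .
qed

lemma part_entropy_nonneg:
  assumes "prob_space M"
  shows "part_entropy M P \<ge> 0"
proof -
  have "measure M A * ln (measure M A) \<le> 0" for A
    using prob_space.prob_le_1[OF assms, of A] by (cases "measure M A = 0")
      (auto simp: mult_le_0_iff zero_less_measure_iff less_le)
  then show ?thesis unfolding part_entropy_def by (simp add: sum_nonpos)
qed

text \<open>Per lattice point, choosing the word costs \<open>O((k + 1)^2 / k^d)\<close>, which is
  \<open>O(1/k)\<close> for \<open>d \<ge> 3\<close>. The channel parameter is fixed first and the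
  approximation of \<open>P\<close> second, so that correct and wrong letters cost at most
  \<open>e/3\<close> each.\<close>

lemma zd_entropy_coin_eq_0:
  fixes g :: "int ^ 'd::finite \<Rightarrow> nat set \<Rightarrow> nat set"
  assumes d3: "CARD('d) \<ge> 3"
    and g: "\<And>n. g n \<in> measurable cantor_borel cantor_borel"
    and pres: "\<And>n. distr coin_measure cantor_borel (g n) = coin_measure"
    and names: "\<And>m. \<exists>C. \<forall>k. card (range (\<lambda>x. restrict (\<lambda>n. g n x \<inter> {..<m}) (cube k))) \<le> 2 ^ (C * (k + 1)\<^sup>2)"
  shows "zd_entropy coin_measure g = 0"
proof -
  let ?a = "\<lambda>P k. part_entropy coin_measure (join_partition coin_measure g P (cube k))
                             / real (card (cube k :: (int ^ 'd) set))"
  have "limsup (\<lambda>k. ereal (?a P k)) = 0" if P: "finite_meas_partition coin_measure P" for P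
  proof (rule antisym)
    have "0 \<le> ereal (?a P k)" for k
      using part_entropy_nonneg[OF coin.prob_space_axioms] by simp
    then show "0 \<le> limsup (\<lambda>k. ereal (?a P k))"
      by (intro le_Limsup) auto
    have "limsup (\<lambda>k. ereal (?a P k)) \<le> 0 + ereal e" if e: "e > 0" for e
    proof -
      \<comment> \<open>Solves \<open>- ln (1 - d) = e / 3\<close>.\<close>
      define d where "d = 1 - exp (- e / 3)"
      have d: "0 < d" "d < 1" "- ln (1 - d) = e / 3" using e by (auto simp: d_def)
      \<comment> \<open>A bound for the cost of a wrong letter; the summand 1 makes it positive, so
        that \<open>e / (3 * b)\<close> is an admissible error.\<close>
      define b where "b = \<bar>ln (card P / d)\<bar> + 1"
      have b: "b > 0" "ln (card P / d) \<le> b" by (auto simp: b_def)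
      have eb: "e / (3 * b) > 0" using e b by simp
      obtain m Q where mQ: "range Q \<subseteq> P \<and> {x. Q (x \<inter> {..<m}) \<noteq> part_cell P x} \<in> sets coin_measure \<and>
          measure coin_measure {x. Q (x \<inter> {..<m}) \<noteq> part_cell P x} < e / (3 * b)"
        using coin_approx_partition[OF P eb] by (elim exE)
      have Q: "\<And>x. Q (x \<inter> {..<m}) \<in> P"
        "{x. Q (x \<inter> {..<m}) \<noteq> part_cell P x} \<in> sets coin_measure"
        "measure coin_measure {x. Q (x \<inter> {..<m}) \<noteq> part_cell P x} < e / (3 * b)"
        using mQ by auto
      let ?E = "{x. Q (x \<inter> {..<m}) \<noteq> part_cell P x}"
      have "ln (card P / d) * measure coin_measure ?E \<le> b * (e / (3 * b))"
        using b Q(3) e by (intro mult_mono) auto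
      then have E: "ln (card P / d) * measure coin_measure ?E \<le> e / 3" using b by simp
      obtain C where C: "\<And>k. card (range (\<lambda>x. restrict (\<lambda>n. g n x \<inter> {..<m}) (cube k))) \<le> 2 ^ (C * (k + 1)\<^sup>2)"
        using names by blast
      have bound: "?a P k \<le> (4 * C * ln 2) / k + 2 * e / 3" if k: "k \<ge> 1" for k
      proof -
        let ?c = "real (card (cube k :: (int ^ 'd) set))"
        have c: "?c = real k ^ CARD('d)" by (simp add: card_cube)
        then have cpos: "?c > 0" using k by simp
        have "(k + 1)\<^sup>2 / ?c \<le> (4 * k\<^sup>2) / real k ^ 3"
        proof (rule frac_le)
          have "(real k + 1)\<^sup>2 \<le> (2 * real k)\<^sup>2" using k by (intro power_mono) auto
          then show "real ((k + 1)\<^sup>2) \<le> real (4 * k\<^sup>2)" by (simp add: power_mult_distrib add.commute)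
          show "real k ^ 3 \<le> ?c" unfolding c using k d3 by (intro power_increasing) auto
        qed (use k in auto)
        also have "(4 * k\<^sup>2) / real k ^ 3 = 4 / k"
          using k by (simp add: power2_eq_square power3_eq_cube)
        finally have ratio: "(k + 1)\<^sup>2 / ?c \<le> 4 / k" .
        have "part_entropy coin_measure (join_partition coin_measure g P (cube k))
           \<le> ln (real (2 ^ (C * (k + 1)\<^sup>2))) + ?c * (- ln (1 - d) + ln (card P / d) * measure coin_measure ?E)"
          using entropy_join_le[OF P finite_cube g pres Q(1,2) d(1,2) C] .
        also have "\<dots> \<le> C * (k + 1)\<^sup>2 * ln 2 + ?c * (2 * e / 3)"
        proof (intro add_mono mult_left_mono)
          show "ln (real (2 ^ (C * (k + 1)\<^sup>2))) \<le> C * (k + 1)\<^sup>2 * ln 2"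
            by (simp add: ln_realpow)
          show "- ln (1 - d) + ln (card P / d) * measure coin_measure ?E \<le> 2 * e / 3"
            using d(3) E by simp
        qed simp
        finally have "?a P k \<le> (C * (k + 1)\<^sup>2 * ln 2 + ?c * (2 * e / 3)) / ?c"
          using cpos by (intro divide_right_mono) auto
        also have "\<dots> = C * ln 2 * ((k + 1)\<^sup>2 / ?c) + 2 * e / 3"
          using cpos by (simp add: field_simps)
        also have "\<dots> \<le> C * ln 2 * (4 / k) + 2 * e / 3"
          by (intro add_right_mono mult_left_mono ratio) simp
        finally show ?thesis by (simp add: mult_ac)
      qed
      have "(\<lambda>k. (4 * C * ln 2) / real k) \<longlonglongrightarrow> 0"
        by (rule lim_const_over_n)
      then have "\<forall>\<^sub>F k in sequentially. (4 * C * ln 2) / real k < e / 3"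
        using e by (intro order_tendstoD(2)) auto
      then have "\<forall>\<^sub>F k in sequentially. ereal (?a P k) \<le> ereal e"
        using eventually_ge_at_top[of 1]
      proof eventually_elim
        case (elim k)
        then show ?case using bound[of k] by simp
      qed
      then show ?thesis by (simp add: Limsup_bounded)
    qed
    then show "limsup (\<lambda>k. ereal (?a P k)) \<le> 0"
      by (rule ereal_le_epsilon2)
  qed
  \<comment> \<open>The supremum must range over a nonempty set to be 0 and not the bottom
    element.\<close>
  moreover have "finite_meas_partition coin_measure {UNIV}"
    using sets.top[of coin_measure] by (auto simp: finite_meas_partition_def disjoint_def)
  ultimately show ?thesis
    unfolding zd_entropy_def by (subst SUP_cong[OF refl, where D = "\<lambda>_. 0"]) (auto simp: SUP_constant)
qed

section \<open>Rational functions over the field with two elements\<close>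

lemma sum_sdiff_char_2:
  fixes b :: "'i \<Rightarrow> 'k::ab_group_add"
  assumes char2: "\<And>a::'k. a + a = 0" and "finite v" "finite w"
  shows "sum b (v \<oplus>\<^sub>s w) = sum b v + sum b w"
proof -
  have "sum b (v \<oplus>\<^sub>s w) = sum b (v - w) + sum b (w - v)"
  proof -
    have "v \<oplus>\<^sub>s w = (v - w) \<union> (w - v)" by auto
    then show ?thesis using assms by (simp only:) (rule sum.union_disjoint; auto)
  qed
  moreover have "sum b v = sum b (v - w) + sum b (v \<inter> w)" "sum b w = sum b (w - v) + sum b (v \<inter> w)"
    using assms by (metis add.commute sum.Int_Diff inf.commute)+
  ultimately show ?thesis using char2[of "sum b (v \<inter> w)"] by (simp add: algebra_simps)
qed

text \<open>An abelian group of exponent two is a vector space over \<open>bit\<close>, in which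
  linear combinations are subset sums. A finite basis would have only finitely many of these, so a
  basis is countably infinite and can be enumerated.\<close>

lemma countable_basis_char_2:
  assumes char2: "\<And>a::'k::ab_group_add. a + a = 0"
    and cnt: "countable (UNIV :: 'k::ab_group_add set)" and inf: "infinite (UNIV :: 'k::ab_group_add set)"
  obtains b :: "nat \<Rightarrow> 'k::ab_group_add" where "\<And>a. \<exists>v. finite v \<and> a = sum b v"
    "\<And>v. finite v \<Longrightarrow> sum b v = 0 \<Longrightarrow> v = {}"
proof -
  interpret vector_space "\<lambda>(c::bit) (a::'k). if c = 0 then 0 else a"
  proof
    fix a b :: bit and x y :: 'k
    show "(if a + b = 0 then 0 else x) = (if a = 0 then 0 else x) + (if b = 0 then 0 else x)"
      using char2[of x] by (cases a; cases b) auto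
  qed simp_all
  define B where "B = extend_basis {}"
  have B: "independent B" "span B = UNIV"
    unfolding B_def using independent_extend_basis span_extend_basis independent_empty by blast+
  have rep: "\<exists>S. finite S \<and> S \<subseteq> B \<and> a = \<Sum>S" for a
  proof -
    let ?S = "{x. representation B a x \<noteq> 0}"
    have "a \<in> span B" using B(2) by simp
    then have "a = (\<Sum>x\<in>?S. if representation B a x = 0 then 0 else x)"
      using sum_nonzero_representation_eq[OF B(1), of a] by simp
    also have "\<dots> = \<Sum>?S" by (intro sum.cong) auto
    finally show ?thesis
      using finite_representation[of B a] representation_ne_zero[of B a] by (intro exI[of _ ?S]) auto
  qed
  have "infinite B"
  proof
    assume "finite B"
    then have "finite (Sum ` Pow B)" by simp
    moreover have "UNIV \<subseteq> Sum ` Pow B" using rep by blast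
    ultimately show False using inf finite_subset by blast
  qed
  then have bij: "bij_betw (from_nat_into B) UNIV B"
    using cnt by (intro bij_betw_from_nat_into) (auto intro: countable_subset)
  let ?b = "from_nat_into B"
  show thesis
  proof
    fix a :: 'k
    obtain S where S: "finite S" "S \<subseteq> B" "a = \<Sum>S" using rep by blast
    have inj: "inj ?b" using bij by (simp add: bij_betw_def)
    have "S = ?b ` (?b -` S)" using S(2) bij by (auto simp: bij_betw_def)
    then have "\<Sum>S = sum ?b (?b -` S)"
      using sum.reindex[of ?b "?b -` S" "\<lambda>x. x"] inj inj_on_subset by (metis comp_def subset_UNIV sum.cong)
    moreover have "finite (?b -` S)" using S(1) inj by (intro finite_vimageI)
    ultimately show "\<exists>v. finite v \<and> a = sum ?b v" using S by blast
  next
    fix v assume v: "finite v" "sum ?b v = 0"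
    have inj: "inj_on ?b v" using bij inj_on_subset by (auto simp: bij_betw_def)
    have "(\<Sum>x\<in>?b ` v. if (1::bit) = 0 then 0 else x) = 0" using v inj by (simp add: sum.reindex)
    moreover have "?b ` v \<subseteq> B" using bij by (auto simp: bij_betw_def)
    ultimately have "(1::bit) = 0" if "x \<in> ?b ` v" for x
      using independentD[OF B(1), of "?b ` v" "\<lambda>_. 1" x] v(1) that by auto
    then show "v = {}" by auto
  qed
qed

section \<open>The field of rational functions and the Euclid polynomials\<close>

type_synonym ratfun = "bit poly fract"

lemma bit_poly_char_2: "p + p = (0 :: bit poly)"
proof (rule poly_eqI)
  fix n
  have "coeff p n + coeff p n = 0" by (cases "coeff p n") auto
  then show "coeff (p + p) n = coeff 0 n" by (simp only: coeff_add coeff_0)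
qed

lemma ratfun_char_2: "a + a = (0 :: ratfun)"
proof -
  have "(1 + 1 :: ratfun) = to_fract (1 + 1)" by (simp only: to_fract_add to_fract_1)
  then have "(1 + 1 :: ratfun) = 0" by (simp only: bit_poly_char_2 to_fract_0)
  then have "a * (1 + 1) = 0" by (simp only: mult_zero_right)
  then show ?thesis by (simp only: distrib_left mult_1_right)
qed

lemma countable_ratfun: "countable (UNIV :: ratfun set)"
proof -
  have "finite (UNIV :: bit set)" 
  proof (rule finite_subset)
    show "UNIV \<subseteq> {0, 1 :: bit}"
    proof
      fix c :: bit show "c \<in> {0, 1}" by (cases c) auto
    qed
  qed simp
  then have "countable (lists (UNIV :: bit set))" by (intro countable_lists countable_finite)
  then have "countable (range (coeffs :: bit poly \<Rightarrow> bit list))" by (rule countable_subset[rotated]) auto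
  then have "countable (UNIV :: bit poly set)"
    by (rule countable_image_inj_on) (auto simp: inj_on_def coeffs_eq_iff)
  then have "countable ((\<lambda>(p, q). Fract p q) ` (UNIV \<times> UNIV :: (bit poly \<times> bit poly) set))"
    by (intro countable_image countable_SIGMA) auto
  moreover have "UNIV \<subseteq> (\<lambda>(p, q). Fract p q) ` (UNIV \<times> UNIV :: (bit poly \<times> bit poly) set)"
  proof
    fix x :: ratfun
    show "x \<in> (\<lambda>(p, q). Fract p q) ` (UNIV \<times> UNIV :: (bit poly \<times> bit poly) set)"
      by (cases x rule: Fract_cases) auto
  qed
  ultimately show ?thesis using countable_subset by blast
qed

lemma infinite_ratfun: "infinite (UNIV :: ratfun set)"
proof -
  have "inj (\<lambda>n. to_fract (monom 1 n) :: ratfun)"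
    by (auto simp: inj_def monom_eq_iff')
  then show ?thesis by (rule infinite_super[OF subset_UNIV range_inj_infinite])
qed

text \<open>Euclid's construction: \<open>euclid_poly n\<close> is 1 plus the product of the indeterminate and all
  previous terms.\<close>

fun euclid_prod :: "nat \<Rightarrow> bit poly" where
  "euclid_prod 0 = [:0, 1:]"
| "euclid_prod (Suc n) = euclid_prod n * (1 + euclid_prod n)"

definition euclid_poly :: "nat \<Rightarrow> bit poly" where
  "euclid_poly n = 1 + euclid_prod n"

text \<open>Adding 1 keeps a positive degree. The product has to start at the indeterminate: started
  at 1 it would give \<open>1 + 1 = 0\<close> in characteristic two.\<close>

lemma degree_euclid_prod: "degree (euclid_prod n) \<ge> 1"
proof (induction n)
  case (Suc n)
  then have "degree (1 + euclid_prod n) = degree (euclid_prod n)"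
    by (intro degree_add_eq_right) simp
  moreover have "euclid_prod n \<noteq> 0" "1 + euclid_prod n \<noteq> 0"
    using Suc calculation by (metis degree_0 not_one_le_zero)+
  ultimately show ?case using Suc by (simp add: degree_mult_eq)
qed simp

lemma degree_euclid_poly: "degree (euclid_poly n) \<ge> 1"
proof -
  have "degree (1 + euclid_prod n) = degree (euclid_prod n)"
    using degree_euclid_prod[of n] by (intro degree_add_eq_right) simp
  then show ?thesis using degree_euclid_prod[of n] by (simp add: euclid_poly_def)
qed

lemma euclid_poly_nonzero: "euclid_poly n \<noteq> 0"
  using degree_euclid_poly[of n] by (metis degree_0 not_one_le_zero)

lemma euclid_poly_dvd_prod: "i < n \<Longrightarrow> euclid_poly i dvd euclid_prod n"
proof (induction n)
  case (Suc n)
  then show ?case by (cases "i = n") (auto simp: euclid_poly_def dvd_mult dvd_mult2)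
qed simp

text \<open>Coprimality in the form in which it is used: modulo an earlier term, every later one is
  1.\<close>

lemma euclid_poly_cong_1: "i < n \<Longrightarrow> euclid_poly i dvd euclid_poly n - 1"
  using euclid_poly_dvd_prod by (simp add: euclid_poly_def)

lemma dvd_prod_minus_1:
  fixes p :: "'a::comm_ring_1"
  assumes "\<And>i. i \<in> I \<Longrightarrow> p dvd f i - 1"
  shows "p dvd prod f I - 1"
  using assms
proof (induction I rule: infinite_finite_induct)
  case (insert i I)
  have "prod f (insert i I) - 1 = f i * (prod f I - 1) + (f i - 1)"
    using insert by (simp add: algebra_simps)
  moreover have "p dvd f i * (prod f I - 1) + (f i - 1)"
    using insert by (intro dvd_add dvd_mult) auto
  ultimately show ?case by (simp only:)
qed auto

lemma dvd_power_minus_1: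
  fixes p :: "'a::comm_ring_1"
  assumes "p dvd a - 1"
  shows "p dvd a ^ n - 1"
  using dvd_prod_minus_1[of "{..<n}" p "\<lambda>_. a"] assms by simp

text \<open>Modulo \<open>euclid_poly (idx j)\<close> the left product vanishes, while on the right
  only later factors occur and the product is 1; a polynomial of positive degree would divide
  1.\<close>

lemma euclid_poly_prod_eqD:
  fixes a b :: "'d::finite \<Rightarrow> nat" and idx :: "'d \<Rightarrow> nat"
  assumes inj: "inj idx"
    and eq: "(\<Prod>i\<in>UNIV. euclid_poly (idx i) ^ a i) = (\<Prod>i\<in>UNIV. euclid_poly (idx i) ^ b i)"
    and j: "a j > 0" "b j = 0" and min: "\<And>i. idx i < idx j \<Longrightarrow> b i = 0"
  shows False
proof -
  let ?p = "euclid_poly (idx j)"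
  have "?p dvd euclid_poly (idx i) ^ b i - 1" for i
  proof (cases "b i = 0")
    case False
    then have "i \<noteq> j" "\<not> idx i < idx j" using j(2) min by auto
    then have "idx j < idx i" using inj by (metis injD linorder_neqE_nat)
    then show ?thesis by (intro dvd_power_minus_1 euclid_poly_cong_1)
  qed simp
  then have 1: "?p dvd (\<Prod>i\<in>UNIV. euclid_poly (idx i) ^ b i) - 1" by (intro dvd_prod_minus_1)
  have 2: "?p dvd (\<Prod>i\<in>UNIV. euclid_poly (idx i) ^ b i)"
    unfolding eq[symmetric] using j(1) by (intro dvd_prodI[THEN dvd_trans[rotated]]) (auto intro: dvd_power)
  have "?p dvd 1" using dvd_diff[OF 2 1] by simp
  then show False using degree_euclid_poly[of "idx j"] by (simp add: is_unit_iff_degree euclid_poly_nonzero)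
qed

section \<open>Monomials in the Euclid polynomials: independence and growth\<close>

definition mono_unit :: "('d \<Rightarrow> nat) \<Rightarrow> int ^ 'd::finite \<Rightarrow> ratfun" where
  "mono_unit idx n = (\<Prod>i\<in>UNIV. to_fract (euclid_poly (idx i)) powi (n $ i))"

lemma mono_unit_add: "mono_unit idx (m + n) = mono_unit idx m * mono_unit idx n"
  by (simp add: mono_unit_def power_int_add euclid_poly_nonzero prod.distrib)

lemma mono_unit_0 [simp]: "mono_unit idx 0 = 1"
  by (simp add: mono_unit_def)

lemma mono_unit_nonzero [simp]: "mono_unit idx n \<noteq> 0"
  by (simp add: mono_unit_def euclid_poly_nonzero)

lemma to_fract_power: "to_fract (p ^ n) = to_fract p ^ n"
  by (induction n) auto

lemma to_fract_prod: "to_fract (prod f I) = (\<Prod>i\<in>I. to_fract (f i))"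
  by (induction I rule: infinite_finite_induct) auto

lemma to_fract_sum: "to_fract (sum f I) = (\<Sum>i\<in>I. to_fract (f i))"
  by (induction I rule: infinite_finite_induct) auto

text \<open>Multiplicative independence. Separating exponents by sign clears denominators, and the
  coordinate with least \<open>idx\<close> in the support of \<open>n\<close> is refuted modulo its
  polynomial; a negative exponent there swaps the two sides.\<close>

lemma mono_unit_eq_1D:
  fixes n :: "int ^ 'd::finite"
  assumes inj: "inj idx" and eq: "mono_unit idx n = 1"
  shows "n = 0"
proof (rule ccontr)
  assume "n \<noteq> 0"
  then have "{i. n $ i \<noteq> 0} \<noteq> {}" by (auto simp: vec_eq_iff)
  then obtain j where j: "n $ j \<noteq> 0" and min: "\<And>i. n $ i \<noteq> 0 \<Longrightarrow> idx j \<le> idx i"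
    using arg_min_if_finite[of "{i. n $ i \<noteq> 0}" idx] by (metis (mono_tags, lifting) finite mem_Collect_eq not_le)
  let ?a = "\<lambda>i. nat (n $ i)" and ?b = "\<lambda>i. nat (- n $ i)" and ?e = "\<lambda>i. to_fract (euclid_poly (idx i))"
  have "?e i powi (n $ i) = ?e i ^ ?a i / ?e i ^ ?b i" for i
    by (cases "n $ i \<ge> 0") (auto simp: power_int_def field_simps)
  then have "mono_unit idx n = (\<Prod>i\<in>UNIV. ?e i ^ ?a i) / (\<Prod>i\<in>UNIV. ?e i ^ ?b i)"
    by (simp add: mono_unit_def prod_dividef)
  moreover have "(\<Prod>i\<in>UNIV. ?e i ^ ?b i) \<noteq> 0" by (simp add: euclid_poly_nonzero)
  ultimately have "(\<Prod>i\<in>UNIV. ?e i ^ ?a i) = (\<Prod>i\<in>UNIV. ?e i ^ ?b i)"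
    using eq by simp
  then have e: "(\<Prod>i\<in>UNIV. euclid_poly (idx i) ^ ?a i) = (\<Prod>i\<in>UNIV. euclid_poly (idx i) ^ ?b i)"
    by (simp flip: to_fract_power to_fract_prod)
  have z: "n $ i = 0" if "idx i < idx j" for i using min[of i] that by auto
  show False
  proof (cases "n $ j > 0")
    case True
    then show False using z by (intro euclid_poly_prod_eqD[OF inj e, of j]) auto
  next
    case False
    then show False using z j by (intro euclid_poly_prod_eqD[OF inj e[symmetric], of j]) auto
  qed
qed

lemma bit_poly_sum_monom:
  fixes p :: "bit poly"
  assumes "degree p < N"
  shows "\<exists>v\<subseteq>{..<N}. p = (\<Sum>l\<in>v. monom 1 l)"
proof (intro exI conjI)
  let ?v = "{l. l < N \<and> coeff p l \<noteq> 0}"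
  have "p = (\<Sum>l\<le>N - 1. monom (coeff p l) l)"
    using assms by (subst poly_as_sum_of_monoms') auto
  also have "{..N - 1} = {..<N}" using assms by auto
  also have "(\<Sum>l<N. monom (coeff p l) l) = (\<Sum>l\<in>?v. monom (coeff p l) l)"
    by (intro sum.mono_neutral_right) auto
  also have "\<dots> = (\<Sum>l\<in>?v. monom 1 l)"
    by (intro sum.cong refl) auto
  finally show "p = (\<Sum>l\<in>?v. monom 1 l)" .
qed auto

lemma common_denominator:
  fixes A :: "'a::idom fract set"
  assumes "finite A"
  shows "\<exists>q. q \<noteq> 0 \<and> (\<forall>a\<in>A. \<exists>f. a = to_fract f / to_fract q)"
  using assms
proof (induction A rule: finite_induct)
  case empty
  then show ?case by (intro exI[of _ 1]) auto
next
  case (insert a A)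
  then obtain q where q: "q \<noteq> 0" "\<forall>a\<in>A. \<exists>f. a = to_fract f / to_fract q" by blast
  obtain f r where fr: "a = to_fract f / to_fract r" "r \<noteq> 0"
    by (metis Fract_cases Fract_conv_to_fract)
  have "\<exists>f. c = to_fract f / to_fract (q * r)" if c: "c \<in> insert a A" for c
  proof (cases "c = a")
    case True
    then show ?thesis using fr q by (intro exI[of _ "f * q"]) auto
  next
    case False
    then obtain h where "c = to_fract h / to_fract q" using c q by auto
    then show ?thesis using fr q by (intro exI[of _ "h * r"]) auto
  qed
  then show ?case using fr q by (intro exI[of _ "q * r"]) auto
qed

text \<open>Exponents in a cube are nonnegative, so a common denominator \<open>q\<close> of
  \<open>A\<close> serves all translates, and the numerators have degree linear in \<open>k\<close>.
  The family \<open>w\<close> of monomials over \<open>q\<close> does not depend on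
  \<open>k\<close>.\<close>

lemma mono_unit_growth:
  fixes idx :: "'d::finite \<Rightarrow> nat" and A :: "ratfun set"
  assumes A: "finite A"
  shows "\<exists>C w. \<forall>k. \<forall>n\<in>cube k. \<forall>a\<in>A. \<exists>v\<subseteq>{..<C * (k + 1)}. mono_unit idx n * a = sum w v"
proof -
  obtain q where q: "q \<noteq> 0" "\<forall>a\<in>A. \<exists>f. a = to_fract f / to_fract q"
    using common_denominator[OF A] by blast
  then obtain f where f: "\<And>a. a \<in> A \<Longrightarrow> a = to_fract (f a) / to_fract q" by metis
  define c where "c = (\<Sum>a\<in>A. degree (f a))"
  have c: "degree (f a) \<le> c" if "a \<in> A" for a
    unfolding c_def using A that by (intro member_le_sum) auto
  define D where "D = (\<Sum>i\<in>UNIV. degree (euclid_poly (idx i)))"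
  \<comment> \<open>Chosen so that the degree bound \<open>D * k + c\<close> is strictly below
    \<open>C * (k + 1)\<close>.\<close>
  define C where "C = D + c + 1"
  define w where "w l = to_fract (monom 1 l) / to_fract q" for l
  have "\<exists>v\<subseteq>{..<C * (k + 1)}. mono_unit idx n * a = sum w v" if n: "n \<in> cube k" and a: "a \<in> A" for k n a
  proof -
    define p where "p = (\<Prod>i\<in>UNIV. euclid_poly (idx i) ^ nat (n $ i)) * f a"
    have n': "n $ i \<ge> 0" "nat (n $ i) \<le> k" for i using n by (auto simp: cube_def nat_le_iff less_imp_le)
    have "degree p \<le> degree (\<Prod>i\<in>UNIV. euclid_poly (idx i) ^ nat (n $ i)) + degree (f a)"
      unfolding p_def by (rule degree_mult_le)
    also have "degree (\<Prod>i\<in>UNIV. euclid_poly (idx i) ^ nat (n $ i))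
        = (\<Sum>i\<in>UNIV. degree (euclid_poly (idx i) ^ nat (n $ i)))"
      by (intro degree_prod_eq_sum_degree) (simp add: euclid_poly_nonzero)
    also have "\<dots> \<le> (\<Sum>i\<in>UNIV. degree (euclid_poly (idx i)) * k)"
      using n' by (intro sum_mono) (simp add: degree_power_eq euclid_poly_nonzero)
    also have "\<dots> = D * k" by (simp add: D_def sum_distrib_right)
    also have "degree (f a) \<le> c" by (rule c[OF a])
    finally have "degree p < C * (k + 1)" by (simp add: C_def algebra_simps)
    then obtain v where v: "v \<subseteq> {..<C * (k + 1)}" "p = (\<Sum>l\<in>v. monom 1 l)"
      using bit_poly_sum_monom by blast
    have "mono_unit idx n = to_fract (\<Prod>i\<in>UNIV. euclid_poly (idx i) ^ nat (n $ i))"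
      using n' by (simp add: mono_unit_def to_fract_prod to_fract_power power_int_def)
    then have "mono_unit idx n * a = to_fract p / to_fract q"
      by (subst f[OF a]) (simp add: p_def)
    also have "\<dots> = sum w v" by (simp add: v(2) to_fract_sum w_def sum_divide_distrib)
    finally show ?thesis using v(1) by blast
  qed
  then show ?thesis by blast
qed

section \<open>The action and the shear\<close>

abbreviation lin_index :: "nat \<Rightarrow> nat" where
  "lin_index i \<equiv> 2 * i"

text \<open>As \<open>prod_encode (i, j)\<close> is at least \<open>i\<close> and \<open>j\<close>,
  the position of a bilinear coordinate lies above those of both linear coordinates. This makes the
  shear triangular.\<close>

definition bil_index :: "nat \<times> nat \<Rightarrow> nat" where
  "bil_index p = 2 * prod_encode p + 1"

definition lin_part :: "nat set \<Rightarrow> nat set" where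
  "lin_part x = lin_index -` x"

definition bil_part :: "nat set \<Rightarrow> (nat \<times> nat) set" where
  "bil_part x = bil_index -` x"

definition glue :: "nat set \<Rightarrow> (nat \<times> nat) set \<Rightarrow> nat set" where
  "glue x y = lin_index ` x \<union> bil_index ` y"

lemma inj_lin_index: "inj lin_index"
  by (auto simp: inj_def)

lemma inj_bil_index: "inj bil_index"
  by (auto simp: inj_def bil_index_def dest: prod_encode_eq[THEN iffD1])

lemma lin_index_neq_bil_index: "2 * i \<noteq> bil_index p"
  unfolding bil_index_def by presburger

lemma index_cases:
  obtains (lin) i where "m = 2 * i" | (bil) i j where "m = bil_index (i, j)"
proof (cases "even m")
  case True
  then show ?thesis using lin by blast
next
  case False
  then have "m = bil_index (prod_decode (m div 2))" by (simp add: bil_index_def)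
  then show ?thesis using bil by (metis surj_pair)
qed

lemma mem_lin_part [simp]: "i \<in> lin_part x \<longleftrightarrow> 2 * i \<in> x"
  and mem_bil_part [simp]: "p \<in> bil_part x \<longleftrightarrow> bil_index p \<in> x"
  by (simp_all add: lin_part_def bil_part_def)

lemma mem_glue_lin [simp]: "2 * i \<in> glue x y \<longleftrightarrow> i \<in> x"
  by (auto simp: glue_def lin_index_neq_bil_index)

lemma mem_glue_bil [simp]: "bil_index p \<in> glue x y \<longleftrightarrow> p \<in> y"
  by (auto simp: glue_def inj_image_mem_iff[OF inj_bil_index] lin_index_neq_bil_index[symmetric])

lemma lin_part_glue [simp]: "lin_part (glue x y) = x"
  and bil_part_glue [simp]: "bil_part (glue x y) = y"
  by auto

lemma parts_eqI: "lin_part x = lin_part y \<Longrightarrow> bil_part x = bil_part y \<Longrightarrow> x = y"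
proof (rule Set.set_eqI)
  fix m assume "lin_part x = lin_part y" "bil_part x = bil_part y"
  then show "m \<in> x \<longleftrightarrow> m \<in> y"
    by (cases m rule: index_cases) (metis mem_lin_part, metis mem_bil_part)
qed

lemma pairing_parts:
  assumes "finite v"
  shows "pairing x v \<longleftrightarrow> pairing (lin_part x) (lin_part v) \<noteq> pairing (bil_part x) (bil_part v)"
proof -
  have v: "v = lin_index ` lin_part v \<oplus>\<^sub>s bil_index ` bil_part v"
    by (rule parts_eqI) (auto simp: lin_index_neq_bil_index lin_index_neq_bil_index[symmetric]
        inj_image_mem_iff[OF inj_bil_index])
  have "finite (lin_part v)" "finite (bil_part v)"
    using assms inj_lin_index inj_bil_index by (auto simp: lin_part_def bil_part_def intro: finite_vimageI)
  then have "pairing x (lin_index ` lin_part v \<oplus>\<^sub>s bil_index ` bil_part v) \<longleftrightarrow>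
      pairing x (lin_index ` lin_part v) \<noteq> pairing x (bil_index ` bil_part v)"
    by (intro pairing_sdiff_right) auto
  then show ?thesis
    unfolding v[symmetric] pairing_image[OF inj_lin_index] pairing_image[OF inj_bil_index]
    by (simp add: lin_part_def bil_part_def)
qed

lemma card_range_le_factor:
  assumes "finite (range g)" "\<And>x y. g x = g y \<Longrightarrow> f x = f y"
  shows "card (range f) \<le> card (range g)"
proof -
  have "f x = f (inv_into UNIV g (g x))" for x
    by (rule assms(2)) (simp add: f_inv_into_f)
  then have "range f \<subseteq> (\<lambda>z. f (inv_into UNIV g z)) ` range g" by auto
  then show ?thesis using assms(1) by (meson surj_card_le)
qed

text \<open>With respect to a basis \<open>b\<close> of the rational function field \<open>K\<close>, an additive functional on \<open>K\<close> is a
  subset of \<open>nat\<close> and a biadditive form on \<open>K\<close> is a subset of \<open>nat \<times> nat\<close>.\<close>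

locale ratfun_basis =
  fixes b :: "nat \<Rightarrow> ratfun" and idx :: "'d::finite \<Rightarrow> nat"
  assumes spanning: "\<And>a. \<exists>v. finite v \<and> a = sum b v"
    and independent: "\<And>v. finite v \<Longrightarrow> sum b v = 0 \<Longrightarrow> v = {}"
    and inj_idx: "inj idx"
begin

abbreviation u :: "int ^ 'd \<Rightarrow> ratfun" where
  "u \<equiv> mono_unit idx"

definition coords :: "ratfun \<Rightarrow> nat set" where
  "coords a = (SOME v. finite v \<and> a = sum b v)"

lemma finite_coords [simp]: "finite (coords a)" and sum_coords: "sum b (coords a) = a"
  using someI_ex[OF spanning[of a]] by (simp_all add: coords_def)

lemma coords_sum: "finite v \<Longrightarrow> coords (sum b v) = v"
proof -
  assume v: "finite v"
  have "sum b (coords (sum b v) \<oplus>\<^sub>s v) = sum b v + sum b v"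
    using v by (subst sum_sdiff_char_2[OF ratfun_char_2]) (auto simp: sum_coords)
  then have "coords (sum b v) \<oplus>\<^sub>s v = {}"
    using v by (intro independent finite_sdiff) (auto simp: ratfun_char_2)
  then show ?thesis by simp
qed

lemma coords_basis [simp]: "coords (b i) = {i}"
  using coords_sum[of "{i}"] by simp

lemma coords_add: "coords (a + c) = coords a \<oplus>\<^sub>s coords c"
proof -
  have "a + c = sum b (coords a \<oplus>\<^sub>s coords c)"
    by (subst sum_sdiff_char_2[OF ratfun_char_2]) (auto simp: sum_coords)
  then show ?thesis using coords_sum[OF finite_sdiff[OF finite_coords finite_coords]] by metis
qed

lemma coords_inject: "coords a = coords c \<Longrightarrow> a = c"
  by (metis sum_coords)

definition functional :: "nat set \<Rightarrow> ratfun \<Rightarrow> bool" where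
  "functional x a = pairing x (coords a)"

definition bilform :: "(nat \<times> nat) set \<Rightarrow> ratfun \<Rightarrow> ratfun \<Rightarrow> bool" where
  "bilform y a c = pairing y (coords a \<times> coords c)"

lemma functional_add: "functional x (a + c) = (functional x a \<noteq> functional x c)"
  by (simp add: functional_def coords_add pairing_sdiff_right)

lemma bilform_add_left: "bilform y (a + a') c = (bilform y a c \<noteq> bilform y a' c)"
proof -
  have "(coords a \<oplus>\<^sub>s coords a') \<times> coords c = (coords a \<times> coords c) \<oplus>\<^sub>s (coords a' \<times> coords c)" by auto
  then show ?thesis by (simp add: bilform_def coords_add pairing_sdiff_right)
qed

lemma bilform_add_right: "bilform y a (c + c') = (bilform y a c \<noteq> bilform y a c')"
proof -
  have "coords a \<times> (coords c \<oplus>\<^sub>s coords c') = (coords a \<times> coords c) \<oplus>\<^sub>s (coords a \<times> coords c')" by auto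
  then show ?thesis by (simp add: bilform_def coords_add pairing_sdiff_right)
qed

lemma functional_basis [simp]: "functional x (b i) \<longleftrightarrow> i \<in> x"
  by (simp add: functional_def)

lemma bilform_basis [simp]: "bilform y (b i) (b j) \<longleftrightarrow> (i, j) \<in> y"
  by (simp add: bilform_def)

lemma functional_eqD: "(\<And>x. functional x a = functional x c) \<Longrightarrow> a = c"
  unfolding functional_def by (rule coords_inject, rule pairing_eqD)

lemma additive_eq_on_sum:
  fixes F H :: "ratfun \<Rightarrow> bool"
  assumes F: "\<And>a c. F (a + c) = (F a \<noteq> F c)" and H: "\<And>a c. H (a + c) = (H a \<noteq> H c)"
    and eq: "\<And>l. l \<in> v \<Longrightarrow> F (w l) = H (w l)"
  shows "F (sum w v) = H (sum w v)"
proof -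
  have 0: "\<not> F 0" "\<not> H 0" using F[of 0 0] H[of 0 0] by auto
  show ?thesis using eq by (induction v rule: infinite_finite_induct) (auto simp: 0 F H)
qed

lemma additive_eqI:
  fixes F H :: "ratfun \<Rightarrow> bool"
  assumes "\<And>a c. F (a + c) = (F a \<noteq> F c)" "\<And>a c. H (a + c) = (H a \<noteq> H c)" "\<And>i. F (b i) = H (b i)"
  shows "F a = H a"
  using additive_eq_on_sum[of F H "coords a" b, OF assms] by (simp add: sum_coords)

definition lin_act :: "int ^ 'd \<Rightarrow> nat set \<Rightarrow> nat set" where
  "lin_act n x = {i. functional x (u n * b i)}"

definition bil_act :: "int ^ 'd \<Rightarrow> (nat \<times> nat) set \<Rightarrow> (nat \<times> nat) set" where
  "bil_act n y = {(i, j). bilform y (u n * b i) (u n * b j)}"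

lemma functional_lin_act: "functional (lin_act n x) a = functional x (u n * a)"
  by (rule additive_eqI[where F = "functional (lin_act n x)"])
    (auto simp: functional_add distrib_left lin_act_def)

lemma bilform_bil_act: "bilform (bil_act n y) a c = bilform y (u n * a) (u n * c)"
proof -
  have "bilform (bil_act n y) (b i) c = bilform y (u n * b i) (u n * c)" for i
    by (rule additive_eqI[where F = "bilform (bil_act n y) (b i)"])
      (auto simp: bilform_add_right distrib_left bil_act_def)
  then show ?thesis
    by - (rule additive_eqI[where F = "\<lambda>a. bilform (bil_act n y) a c" and H = "\<lambda>a. bilform y (u n * a) (u n * c)"],
      auto simp: bilform_add_left distrib_left)
qed

text \<open>The matrix of the linear and the bilinear action together, one finite row per position,
  so that the general facts on \<open>dual_map\<close> give additivity, continuity and pullbacks of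
  characters.\<close>

definition rows :: "int ^ 'd \<Rightarrow> nat \<Rightarrow> nat set" where
  "rows n m = (if even m then lin_index ` coords (u n * b (m div 2))
     else case prod_decode (m div 2) of (i, j) \<Rightarrow> bil_index ` (coords (u n * b i) \<times> coords (u n * b j)))"

lemma rows_lin: "rows n (2 * i) = lin_index ` coords (u n * b i)"
  and rows_bil: "rows n (bil_index (i, j)) = bil_index ` (coords (u n * b i) \<times> coords (u n * b j))"
  by (simp_all add: rows_def bil_index_def)

lemma finite_rows: "finite (rows n m)"
  by (cases m rule: index_cases) (auto simp: rows_lin rows_bil)

definition act :: "int ^ 'd \<Rightarrow> nat set \<Rightarrow> nat set" where
  "act n = dual_map (rows n)"

lemma lin_part_act [simp]: "lin_part (act n x) = lin_act n (lin_part x)"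
  by (auto simp: act_def rows_lin pairing_image[OF inj_lin_index] lin_act_def functional_def
      simp flip: lin_part_def)

lemma bil_part_act [simp]: "bil_part (act n x) = bil_act n (bil_part x)"
  by (auto simp: act_def rows_bil pairing_image[OF inj_bil_index] bil_act_def bilform_def
      simp flip: bil_part_def)

lemma lin_act_0 [simp]: "lin_act 0 x = x"
  by (simp add: lin_act_def)

lemma bil_act_0 [simp]: "bil_act 0 y = y"
  by (auto simp: bil_act_def)

text \<open>Transposition reverses composition, which is harmless because multiplication in the
  field commutes.\<close>

lemma lin_act_add: "lin_act (m + n) x = lin_act m (lin_act n x)"
  unfolding lin_act_def[of m] functional_lin_act
  by (simp add: lin_act_def mono_unit_add mult_ac)

lemma bil_act_add: "bil_act (m + n) y = bil_act m (bil_act n y)"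
  unfolding bil_act_def[of m] bilform_bil_act
  by (simp add: bil_act_def mono_unit_add mult_ac)

lemma act_0: "act 0 x = x"
  by (rule parts_eqI) auto

lemma act_add: "act (m + n) x = act m (act n x)"
  by (rule parts_eqI) (auto simp: lin_act_add bil_act_add)

lemma surj_act: "surj (act n)"
proof (rule surjI)
  show "act n (act (- n) x) = x" for x by (simp add: act_0 flip: act_add)
qed

lemma inj_act: "inj (act n)"
proof (rule inj_on_inverseI)
  show "act (- n) (act n x) = x" for x by (simp add: act_0 flip: act_add)
qed

lemma act_locality: "\<exists>l. \<forall>x y. y \<inter> {..<l} = x \<inter> {..<l} \<longrightarrow> act n y \<inter> {..<k} = act n x \<inter> {..<k}"
  unfolding act_def by (rule dual_map_locality) (rule finite_rows)

lemma act_measurable: "act n \<in> measurable cantor_borel cantor_borel"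
  by (rule measurable_cantor) (rule act_locality)

lemma pairing_act: "finite v \<Longrightarrow> \<exists>w. finite w \<and> (\<forall>x. pairing (act n x) v = pairing x w)"
  unfolding act_def by (rule pairing_dual_map) (auto simp: finite_rows)

lemma distr_act: "distr coin_measure cantor_borel (act n) = coin_measure"
  by (rule distr_coin_dual[OF act_measurable pairing_act surj_act])

lemma algebraic_action_act: "algebraic_action cantor_group cantor_topology act"
  unfolding algebraic_action_def cont_aut_def
proof (intro conjI allI ballI)
  fix n
  show "act n \<in> hom cantor_group cantor_group"
    by (rule homI) (auto simp: act_def dual_map_sdiff finite_rows)
  show "bij_betw (act n) (carrier cantor_group) (carrier cantor_group)"
    using inj_act surj_act by (simp add: bij_def)
  show "continuous_map cantor_topology cantor_topology (act n)"
    by (rule continuous_map_cantor) (rule act_locality)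
qed (auto simp: act_0 act_add)

section \<open>Freeness on characters and mixing\<close>

lemma mono_unit_power_eq_1D:
  assumes "u n ^ k = 1" "k > 0"
  shows "n = 0"
proof -
  have "u (\<chi> i. n $ i * int k) = u n ^ k"
    by (simp add: mono_unit_def prod_power_distrib power_int_mult)
  then have "(\<chi> i. n $ i * int k) = (0 :: int ^ 'd)"
    using assms(1) by (intro mono_unit_eq_1D[OF inj_idx]) simp
  then show ?thesis using assms(2) by (auto simp: vec_eq_iff)
qed

text \<open>\<open>v\<close> is read as a tensor in coordinates; its second factor is evaluated at
  the functional \<open>\<psi>\<close>, which leaves an element of the field.\<close>

definition contract :: "(nat \<times> nat) set \<Rightarrow> nat set \<Rightarrow> ratfun" where
  "contract v \<psi> = (\<Sum>p\<in>{p \<in> v. snd p \<in> \<psi>}. b (fst p))"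

lemma functional_0 [simp]: "\<not> functional x 0"
  using functional_add[of x 0 0] by simp

lemma functional_sum_basis:
  assumes "finite S"
  shows "functional \<phi> (\<Sum>p\<in>S. b (h p)) \<longleftrightarrow> odd (card {p \<in> S. h p \<in> \<phi>})"
  using assms
proof (induction S rule: finite_induct)
  case (insert p S)
  have "{q \<in> insert p S. h q \<in> \<phi>} = (if h p \<in> \<phi> then insert p {q \<in> S. h q \<in> \<phi>} else {q \<in> S. h q \<in> \<phi>})"
    by auto
  then show ?case using insert by (simp add: functional_add)
qed simp

lemma pairing_Times_contract:
  assumes "finite v"
  shows "pairing (\<phi> \<times> \<psi>) v = functional \<phi> (contract v \<psi>)"
proof -
  have "(\<phi> \<times> \<psi>) \<inter> v = {p \<in> {p \<in> v. snd p \<in> \<psi>}. fst p \<in> \<phi>}" by auto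
  then show ?thesis using assms by (simp add: contract_def pairing_def functional_sum_basis)
qed

lemma bil_act_Times: "bil_act n (x \<times> y) = lin_act n x \<times> lin_act n y"
  by (auto simp: bil_act_def lin_act_def bilform_def functional_def pairing_Times)

text \<open>An invariant tensor has a finite set of contractions, and this set is mapped into itself by
  multiplication with \<open>u n\<close>; hence \<open>u n\<close> is a root of unity.\<close>

lemma bil_act_free:
  assumes v: "finite v" "v \<noteq> {}"
    and inv: "\<And>y. pairing (bil_act n y) v = pairing y v"
  shows "n = 0"
proof -
  let ?C = "range (contract v)"
  have "?C \<subseteq> (\<lambda>S. \<Sum>p\<in>S. b (fst p)) ` Pow v" by (auto simp: contract_def)
  then have finC: "finite ?C" using v(1) finite_subset by blast
  \<comment> \<open>Invariance tested on pure tensors: with \<open>\<psi>\<close> fixed and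
    \<open>\<phi>\<close> arbitrary it becomes an identity of field elements.\<close>
  have eq: "u n * contract v (lin_act n \<psi>) = contract v \<psi>" for \<psi>
  proof (rule functional_eqD)
    fix \<phi>
    show "functional \<phi> (u n * contract v (lin_act n \<psi>)) = functional \<phi> (contract v \<psi>)"
      using inv[of "\<phi> \<times> \<psi>"] v(1)
      by (simp add: bil_act_Times pairing_Times_contract functional_lin_act)
  qed
  \<comment> \<open>\<open>lin_act n\<close> is onto, so every contraction can be written with a
    moved functional and \<open>eq\<close> applies.\<close>
  have step: "u n * c \<in> ?C" if c: "c \<in> ?C" for c
  proof -
    obtain \<psi> where "c = contract v \<psi>" using c by blast
    then have "c = contract v (lin_act n (lin_act (- n) \<psi>))" by (simp flip: lin_act_add)
    then show ?thesis using eq[of "lin_act (- n) \<psi>"] by auto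
  qed
  obtain i0 j0 where ij: "(i0, j0) \<in> v" using v(2) by auto
  \<comment> \<open>The functional dual to \<open>b j0\<close> extracts one column of
    \<open>v\<close>, which is nonempty by the choice of \<open>j0\<close>, so \<open>c\<close> is
    nonzero; its multiples by powers of \<open>u n\<close> then repeat inside the finite set of
    contractions.\<close>
  define c where "c = contract v {j0}"
  have c: "c = sum b {i. (i, j0) \<in> v}"
    unfolding c_def contract_def
    by (rule sum.reindex_bij_witness[where i = "\<lambda>i. (i, j0)" and j = fst]) auto
  have fin: "finite {i. (i, j0) \<in> v}"
    by (rule finite_subset[OF _ finite_imageI[OF v(1), of fst]]) force
  have c0: "c \<noteq> 0"
  proof
    assume "c = 0"
    then have "{i. (i, j0) \<in> v} = {}" using independent[OF fin] by (simp only: c)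
    then show False using ij by blast
  qed
  have "u n ^ k * c \<in> ?C" for k
  proof (induction k)
    case (Suc k)
    then show ?case using step by (simp add: mult.assoc)
  qed (simp add: c_def)
  then have "range (\<lambda>k::nat. u n ^ k * c) \<subseteq> ?C" by blast
  then have "finite (range (\<lambda>k::nat. u n ^ k * c))" using finC finite_subset by blast
  then have "\<not> inj (\<lambda>k::nat. u n ^ k * c)" using range_inj_infinite by blast
  then obtain k l where kl: "k < l" "u n ^ k = u n ^ l"
    using c0 by (auto simp: inj_def) (metis linorder_neqE_nat)
  have "u n ^ k * u n ^ (l - k) = u n ^ l" using kl(1) by (simp flip: power_add)
  then have "u n ^ k * u n ^ (l - k) = u n ^ k * 1" by (simp only: kl(2) mult_1_right)
  then have "u n ^ (l - k) = 1" by (simp only: mult_cancel_left) simp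
  then show ?thesis using kl(1) mono_unit_power_eq_1D[of n "l - k"] by simp
qed

text \<open>Invariance says that \<open>u n\<close> fixes the nonzero field element with coordinates
  \<open>v\<close>; cancelling it leaves \<open>u n = 1\<close>.\<close>

lemma lin_act_free:
  assumes v: "finite v" "v \<noteq> {}"
    and inv: "\<And>x. pairing (lin_act n x) v = pairing x v"
  shows "n = 0"
proof -
  let ?a = "sum b v"
  have "functional x (u n * ?a) = functional x ?a" for x
    unfolding functional_lin_act[symmetric] using inv[of x] v(1) by (simp add: functional_def coords_sum)
  then have "u n * ?a = ?a" by (rule functional_eqD)
  moreover have "?a \<noteq> 0" using independent v by blast
  ultimately have "u n = 1" by simp
  then show ?thesis by (rule mono_unit_eq_1D[OF inj_idx])
qed

lemma functional_empty [simp]: "\<not> functional {} a" and bilform_empty [simp]: "\<not> bilform {} a c"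
  by (simp_all add: functional_def bilform_def)

lemma act_free:
  assumes v: "finite v" "v \<noteq> {}"
    and inv: "\<And>x. pairing (act n x) v = pairing x v"
  shows "n = 0"
proof -
  have e: "lin_act n {} = {}" "bil_act n {} = {}" by (auto simp: lin_act_def bil_act_def)
  have fin: "finite (lin_part v)" "finite (bil_part v)"
    using v(1) inj_lin_index inj_bil_index by (auto simp: lin_part_def bil_part_def intro: finite_vimageI)
  have 1: "pairing (lin_act n x) (lin_part v) = pairing x (lin_part v)" for x
    using inv[of "glue x {}"] v(1) by (simp add: pairing_parts e)
  have 2: "pairing (bil_act n y) (bil_part v) = pairing y (bil_part v)" for y
    using inv[of "glue {} y"] v(1) by (simp add: pairing_parts e)
  have "lin_part v \<noteq> {} \<or> bil_part v \<noteq> {}"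
    using v(2) parts_eqI[of v "{}"] by (auto simp: lin_part_def bil_part_def)
  then show ?thesis using lin_act_free[OF fin(1) _ 1] bil_act_free[OF fin(2) _ 2] by blast
qed

text \<open>If the pullbacks of \<open>w\<close> by \<open>m\<close> and by \<open>n\<close> agree,
  then \<open>m - n\<close> stabilizes \<open>w\<close>. So by freeness each of the finitely many
  pairs \<open>v\<close>, \<open>w\<close> below \<open>k\<close> with \<open>w\<close> nontrivial
  excludes at most one lattice point.\<close>

lemma mixing_act: "mixing_action coin_measure act"
proof (rule mixing_coinI[OF act_measurable distr_act])
  fix k
  let ?bad = "\<lambda>v w. {n. \<forall>x. pairing (act n x) w = pairing x v}"
  have bad: "finite (?bad v w)" if w: "finite w" "w \<noteq> {}" for v w
  proof -
    have "m = n" if m: "m \<in> ?bad v w" and n: "n \<in> ?bad v w" for m n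
    proof -
      have "pairing (act (m - n) x) w = pairing x w" for x
      proof -
        have "pairing (act (m - n) x) w = pairing (act m (act (- n) x)) w"
          by (simp flip: act_add)
        also have "\<dots> = pairing (act n (act (- n) x)) w" using m n by simp
        also have "\<dots> = pairing x w" by (simp add: act_0 flip: act_add)
        finally show ?thesis .
      qed
      then show ?thesis using act_free[OF w] by fastforce
    qed
    then have "?bad v w \<subseteq> {n} \<or> ?bad v w = {}" if "n \<in> ?bad v w" for n using that by blast
    then show ?thesis by (metis (no_types, lifting) all_not_in_conv finite.emptyI finite.insertI finite_subset)
  qed
  have fin: "finite (\<Union>v\<in>Pow {..<k}. \<Union>w\<in>Pow {..<k} - {{}}. ?bad v w)"
  proof (intro finite_UN_I)
    fix v w assume "w \<in> Pow {..<k} - {{}}"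
    then show "finite (?bad v w)" using bad finite_subset[of w "{..<k}"] by blast
  qed auto
  have "\<forall>\<^sub>F n in cofinite. n \<notin> (\<Union>v\<in>Pow {..<k}. \<Union>w\<in>Pow {..<k} - {{}}. ?bad v w)"
    using fin by (simp add: eventually_cofinite)
  then show "\<forall>\<^sub>F n in cofinite. \<forall>c d. c \<subseteq> {..<k} \<longrightarrow> d \<subseteq> {..<k} \<longrightarrow>
      measure coin_measure (cylinder k {c} \<inter> act n -` cylinder k {d}) = (1/4)^k"
  proof eventually_elim
    case (elim n)
    show ?case
    proof (intro allI impI measure_atom_Int_vimage[OF act_measurable pairing_act])
      fix v w assume "v \<subseteq> {..<k}" "w \<subseteq> {..<k}" "\<And>x. pairing (act n x) w = pairing x v"
      then show "w = {}" using elim by blast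
    qed
  qed
qed

text \<open>All field elements needed over the cube are subset sums of
  \<open>L = C * (k + 1)\<close> elements \<open>w l\<close>. By additivity the name depends only on
  the \<open>L\<close> values of the functional and the \<open>L * L\<close> values of the form on
  them.\<close>

lemma act_names:
  "\<exists>C. \<forall>k. card (range (\<lambda>x. restrict (\<lambda>n. act n x \<inter> {..<m}) (cube k))) \<le> 2 ^ (C * (k + 1)\<^sup>2)"
proof -
  obtain C w where Cw: "\<forall>k. \<forall>n\<in>cube k. \<forall>a\<in>b ` {..<m}. \<exists>v\<subseteq>{..<C * (k + 1)}. u n * a = sum w v"
    using mono_unit_growth[of "b ` {..<m}" idx] by blast
  have "card (range (\<lambda>x. restrict (\<lambda>n. act n x \<inter> {..<m}) (cube k))) \<le> 2 ^ ((C + C\<^sup>2) * (k + 1)\<^sup>2)" for k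
  proof -
    define L where "L = C * (k + 1)"
    define g where "g x = ({l. l < L \<and> functional (lin_part x) (w l)},
      {(l, l'). l < L \<and> l' < L \<and> bilform (bil_part x) (w l) (w l')})" for x
    have sub: "range g \<subseteq> Pow {..<L} \<times> Pow ({..<L} \<times> {..<L})"
      by (auto simp: g_def)
    have fing: "finite (range g)" by (rule finite_subset[OF sub]) auto
    have eq: "act n x \<inter> {..<m} = act n y \<inter> {..<m}" if xy: "g x = g y" and n: "n \<in> cube k" for x y n
    proof -
      have lin: "functional (lin_part x) (w l) = functional (lin_part y) (w l)" if "l < L" for l
        using xy that by (auto simp: g_def set_eq_iff)
      have bil: "bilform (bil_part x) (w l) (w l') = bilform (bil_part y) (w l) (w l')" if "l < L" "l' < L" for l l'
        using xy that by (auto simp: g_def set_eq_iff)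
      have ex: "\<exists>v\<subseteq>{..<L}. u n * b i = sum w v" if "i < m" for i
        using Cw n that by (auto simp: L_def)
      have "h \<in> act n x \<longleftrightarrow> h \<in> act n y" if h: "h < m" for h
      proof (cases h rule: index_cases)
        case (lin i)
        then obtain v where v: "v \<subseteq> {..<L}" "u n * b i = sum w v" using ex[of i] h by auto
        have "functional (lin_part x) (sum w v) = functional (lin_part y) (sum w v)"
          using v(1) \<open>\<And>l. l < L \<Longrightarrow> functional (lin_part x) (w l) = functional (lin_part y) (w l)\<close>
          by - (rule additive_eq_on_sum[where F = "functional (lin_part x)" and H = "functional (lin_part y)"],
              auto simp: functional_add)
        then have "i \<in> lin_part (act n x) \<longleftrightarrow> i \<in> lin_part (act n y)"
          unfolding lin_part_act lin_act_def by (simp add: v(2))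
        then show ?thesis by (simp only: lin mem_lin_part)
      next
        case (bil i j)
        have "i < m" "j < m"
          using h le_prod_encode_1[of i j] le_prod_encode_2[of j i] unfolding bil bil_index_def by linarith+
        then obtain v v' where v: "v \<subseteq> {..<L}" "u n * b i = sum w v" and v': "v' \<subseteq> {..<L}" "u n * b j = sum w v'"
          using ex by meson
        have "bilform (bil_part x) (w l) (sum w v') = bilform (bil_part y) (w l) (sum w v')" if "l < L" for l
          using v'(1) that \<open>\<And>l l'. l < L \<Longrightarrow> l' < L \<Longrightarrow> bilform (bil_part x) (w l) (w l') = bilform (bil_part y) (w l) (w l')\<close>
          by - (rule additive_eq_on_sum[where F = "bilform (bil_part x) (w l)" and H = "bilform (bil_part y) (w l)"],
              auto simp: bilform_add_right)
        then have "bilform (bil_part x) (sum w v) (sum w v') = bilform (bil_part y) (sum w v) (sum w v')"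
          using v(1)
          by - (rule additive_eq_on_sum[where F = "\<lambda>a. bilform (bil_part x) a (sum w v')"
                and H = "\<lambda>a. bilform (bil_part y) a (sum w v')"], auto simp: bilform_add_left)
        then have "(i, j) \<in> bil_part (act n x) \<longleftrightarrow> (i, j) \<in> bil_part (act n y)"
          unfolding bil_part_act bil_act_def by (simp add: v(2) v'(2))
        then show ?thesis by (simp only: bil mem_bil_part)
      qed
      then show ?thesis by auto
    qed
    have "card (range (\<lambda>x. restrict (\<lambda>n. act n x \<inter> {..<m}) (cube k))) \<le> card (range g)"
    proof (rule card_range_le_factor[OF fing])
      fix x y assume "g x = g y"
      then show "restrict (\<lambda>n. act n x \<inter> {..<m}) (cube k) = restrict (\<lambda>n. act n y \<inter> {..<m}) (cube k)"
        by (intro restrict_ext eq)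
    qed
    also have "\<dots> \<le> card (Pow {..<L} \<times> Pow ({..<L} \<times> {..<L}))"
      by (rule card_mono[OF _ sub]) auto
    also have "\<dots> = 2 ^ (L + L * L)"
      by (simp add: card_cartesian_product card_Pow power_add)
    also have "\<dots> \<le> 2 ^ ((C + C\<^sup>2) * (k + 1)\<^sup>2)"
    proof (rule power_increasing)
      have "L \<le> C * (k + 1)\<^sup>2"
        unfolding L_def by (intro mult_left_mono) (auto simp: power2_eq_square)
      moreover have "L * L = C\<^sup>2 * (k + 1)\<^sup>2"
        by (simp only: L_def power2_eq_square mult_ac)
      ultimately show "L + L * L \<le> (C + C\<^sup>2) * (k + 1)\<^sup>2"
        by (simp only: distrib_right add_right_mono)
    qed simp
    finally show ?thesis .
  qed
  then show ?thesis by blast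
qed

end

section \<open>The shear and the main result\<close>

definition shear :: "nat set \<Rightarrow> nat set" where
  "shear x = glue (lin_part x) (bil_part x \<oplus>\<^sub>s (lin_part x \<times> lin_part x))"

lemma shear_involution: "shear (shear x) = x"
  by (rule parts_eqI) (auto simp: shear_def)

text \<open>The coordinate at \<open>bil_index (i, j)\<close> is changed by the product of those at
  \<open>2 * i\<close> and \<open>2 * j\<close>, which stand earlier.\<close>

lemma shear_triangular:
  assumes "y \<inter> {..<k} = x \<inter> {..<k}"
  shows "shear y \<inter> {..<k} = shear x \<inter> {..<k}"
proof -
  have eq: "m \<in> y \<longleftrightarrow> m \<in> x" if "m < k" for m using assms that by (metis IntI Int_iff lessThan_iff)
  have "m \<in> shear y \<longleftrightarrow> m \<in> shear x" if "m < k" for m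
  proof (cases m rule: index_cases)
    case (lin i)
    then show ?thesis using eq that by (simp add: shear_def)
  next
    case (bil i j)
    have "2 * i < k" "2 * j < k"
      using that le_prod_encode_1[of i j] le_prod_encode_2[of j i] unfolding bil bil_index_def by linarith+
    then show ?thesis using eq that bil by (simp add: shear_def)
  qed
  then show ?thesis by auto
qed

lemma homeomorphic_map_shear: "homeomorphic_map cantor_topology cantor_topology shear"
  by (intro homeomorphic_map_involution continuous_map_cantor shear_involution)
    (use shear_triangular in blast)

lemma measure_preserving_shear: "measure_preserving_map coin_measure shear"
  by (intro measure_preserving_coinI distr_coin_triangular_involution measurable_cantor
      shear_involution shear_triangular) (use shear_triangular in blast)+

lemma AE_coin_translate:
  assumes "AE x in coin_measure. Q x"
  shows "AE x in coin_measure. Q (z \<oplus>\<^sub>s x)"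
proof -
  have "AE x in distr coin_measure cantor_borel ((\<oplus>\<^sub>s) z). Q x"
    unfolding distr_coin_translate by (rule assms)
  moreover have "(\<oplus>\<^sub>s) z \<in> measurable coin_measure cantor_borel"
    using translate_measurable by (simp cong: measurable_cong_sets)
  ultimately show ?thesis by (rule AE_distrD[rotated])
qed

text \<open>The second difference of \<open>shear\<close> in the directions of two basis functionals does not vanish.\<close>

lemma not_affine_shear: "\<not> affine_map cantor_group cantor_topology coin_measure shear"
proof
  assume "affine_map cantor_group cantor_topology coin_measure shear"
  then obtain c \<theta> where hom: "\<theta> \<in> hom cantor_group cantor_group"
    and ae: "AE x in coin_measure. shear x = c \<oplus>\<^sub>s \<theta> x"
    by (auto simp: affine_map_def)
  have add: "\<theta> (x \<oplus>\<^sub>s y) = \<theta> x \<oplus>\<^sub>s \<theta> y" for x y using hom_mult[OF hom, of x y] by simp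
  define e :: "nat \<Rightarrow> nat set" where "e i = {2 * i}" for i
  let ?Q = "\<lambda>x. shear x = c \<oplus>\<^sub>s \<theta> x"
  \<comment> \<open>The affine formula holds only almost everywhere, so a single \<open>x\<close> is
    chosen at which all four corners of a square satisfy it.\<close>
  have "AE x in coin_measure. ?Q x \<and> ?Q (e 0 \<oplus>\<^sub>s x) \<and> ?Q (e 1 \<oplus>\<^sub>s x) \<and> ?Q ((e 0 \<oplus>\<^sub>s e 1) \<oplus>\<^sub>s x)"
    using ae AE_coin_translate[OF ae] by (intro AE_conjI)
  then obtain x where x: "?Q x" "?Q (e 0 \<oplus>\<^sub>s x)" "?Q (e 1 \<oplus>\<^sub>s x)" "?Q ((e 0 \<oplus>\<^sub>s e 1) \<oplus>\<^sub>s x)"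
    using eventually_happens'[OF coin.ae_filter_bot] by blast
  let ?m = "bil_index (0, 1)"
  \<comment> \<open>This chain of equivalences says that the four truth values add up to 0 modulo 2,
    as they must for an affine map. The term \<open>x \<otimes> x\<close> contributes the product of
    coordinates 0 and 2, which is true at exactly one corner.\<close>
  have sum: "(?m \<in> shear x) = ((?m \<in> shear (e 0 \<oplus>\<^sub>s x)) = ((?m \<in> shear (e 1 \<oplus>\<^sub>s x)) = (?m \<in> shear ((e 0 \<oplus>\<^sub>s e 1) \<oplus>\<^sub>s x))))"
    unfolding x add by auto
  have "?m \<in> shear y \<longleftrightarrow> (?m \<in> y) \<noteq> (0 \<in> y \<and> 2 \<in> y)" for y by (simp add: shear_def)
  moreover have "?m \<notin> e 0" "?m \<notin> e 1" "0 \<in> e 0" "2 \<notin> e 0" "0 \<notin> e 1" "2 \<in> e 1"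
    using lin_index_neq_bil_index[of 0 "(0, 1)"] lin_index_neq_bil_index[of 1 "(0, 1)"] by (auto simp: e_def)
  ultimately show False using sum by auto
qed

text \<open>The form is acted on diagonally, so by \<open>bil_act_Times\<close> the square of a
  functional moves to the square of the moved functional.\<close>

lemma (in ratfun_basis) shear_act: "shear (act n x) = act n (shear x)"
proof (rule parts_eqI)
  have "bil_act n (y \<oplus>\<^sub>s z) = bil_act n y \<oplus>\<^sub>s bil_act n z" for y z
    by (auto simp: bil_act_def bilform_def pairing_sdiff_left)
  then show "bil_part (shear (act n x)) = bil_part (act n (shear x))"
    by (simp add: shear_def bil_act_Times)
qed (simp add: shear_def)

theorem theorem1p1:
  assumes "CARD('d::finite) \<ge> 8"
  shows "\<exists>(G :: univ monoid) (T :: univ topology) (M :: univ measure)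
            (\<alpha> :: (int ^ 'd) \<Rightarrow> univ \<Rightarrow> univ) (f :: univ \<Rightarrow> univ).
           compact_zd_abelian_group G T \<and> is_haar G T M \<and>
           algebraic_action G T \<alpha> \<and> mixing_action M \<alpha> \<and> zd_entropy M \<alpha> = 0 \<and>
           homeomorphic_map T T f \<and> measure_preserving_map M f \<and>
           (\<forall>n. \<forall>x \<in> carrier G. f (\<alpha> n x) = \<alpha> n (f x)) \<and>
           \<not> affine_map G T M f"
proof -
  obtain b :: "nat \<Rightarrow> ratfun" where b: "\<And>a. \<exists>v. finite v \<and> a = sum b v"
    "\<And>v. finite v \<Longrightarrow> sum b v = 0 \<Longrightarrow> v = {}"
    using countable_basis_char_2[OF ratfun_char_2 countable_ratfun infinite_ratfun] by blast
  obtain idx :: "'d \<Rightarrow> nat" where "inj idx"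
    using finite_imp_inj_to_nat_seg[of "UNIV :: 'd set"] by auto
  then interpret ratfun_basis b idx using b by unfold_locales
  have "zd_entropy coin_measure act = 0"
    using assms by (intro zd_entropy_coin_eq_0 act_measurable distr_act act_names) simp
  then show ?thesis
    using compact_zd_abelian_group_cantor is_haar_coin algebraic_action_act mixing_act
      homeomorphic_map_shear measure_preserving_shear shear_act not_affine_shear
    by blast
qed

end
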